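(* Let $p$ be a prime, $k\ge 1$ an integer, $q=p^k$, and let $\mu(\lambda)=\lambda^k+a_{k-1}\lambda^{k-1}+\cdots+a_1\lambda+a_0$ be a monic primitive polynomial for the field $F_q$ with coefficients in the prime field $F_p$ (the $a_i$ regarded as integers in $\{0,\dots,p-1\}$). Put $v_q=1$ if $q$ is even and $v_q=v^{(q-1)/2}$ if $q$ is odd; put $\ell=q$ if $q\in\{2,3\}$, $\ell=q-1$ if $q$ is even with $q\ne 2$ or $q\equiv 1 \pmod 4$, and $\ell=(q-1)/2$ if $q\equiv 3\pmod 4$ with $q\neq 3$. Let $H$ be the group with generators $u,v$ and the following $k+4$ defining relators: $v^{q-1}$, $(uv)^2$, $u^\ell$, $(uvv_q)^p$; $[uvv_q,\, v^i(uvv_q)v^{-i}]$ for $1\le i\le k-1$; and $W(u,v;\mu)=v^k(uvv_q)v^{-k}\prod_{i=0}^{k-1}\big(v^i(uvv_q)v^{-i}\big)^{a_i}$ (product taken with $i$ increasing from left to right). Then $H$ is isomorphic to $\mathrm{AGL}(1,q)$.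
   Context: A monic primitive polynomial for $F_q$ over $F_p$ is a monic irreducible polynomial of degree $k$ over $F_p$ whose roots are primitive elements (generators of the multiplicative group) of $F_q$. $[a,b]=a^{-1}b^{-1}ab$. $\mathrm{AGL}(1,q)\cong F_q^+\rtimes F_q^\times$ is the affine general linear group of the line over $F_q$. *)

theory Defs
  imports
    "HOL-Number_Theory.Residues"
    "HOL-Algebra.Algebra"
begin

section \<open>Free groups and group presentations\<close>

text \<open>
  A word over \<open>'g\<close> is a list of letters; \<open>(g, True)\<close> stands for the generator \<open>g\<close> and
  \<open>(g, False)\<close> for its formal inverse.  The generating set is the whole type \<open>'g\<close>.
\<close>

type_synonym 'g word = "('g \<times> bool) list"

inductive free_eq :: "'g word \<Rightarrow> 'g word \<Rightarrow> bool" where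
  cancel: "free_eq (xs @ [(g, b), (g, \<not> b)] @ ys) (xs @ ys)"
| refl: "free_eq xs xs"
| sym: "free_eq xs ys \<Longrightarrow> free_eq ys xs"
| trans: "free_eq xs ys \<Longrightarrow> free_eq ys zs \<Longrightarrow> free_eq xs zs"

definition free_rel :: "('g word \<times> 'g word) set" where
  "free_rel = {(xs, ys). free_eq xs ys}"

definition free_group :: "'g word set monoid" where
  "free_group =
     \<lparr>carrier = UNIV // free_rel,
      monoid.mult = (\<lambda>A B. \<Union>a\<in>A. \<Union>b\<in>B. free_rel `` {a @ b}),
      one = free_rel `` {[]}\<rparr>"

lemma equiv_free_rel: "equiv UNIV free_rel"
proof (rule equivI)
  show "refl free_rel"
    by (simp add: refl_on_def free_rel_def free_eq.refl)
  show "sym free_rel"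
    by (simp add: sym_def free_rel_def free_eq.sym)
  show "trans free_rel"
    unfolding trans_def free_rel_def using free_eq.trans by blast
qed simp

lemma free_eq_append_left: "free_eq xs ys \<Longrightarrow> free_eq (zs @ xs) (zs @ ys)"
proof (induction rule: free_eq.induct)
  case (cancel xs g b ys)
  show ?case using free_eq.cancel[of "zs @ xs" g b ys] by simp
next
  case (trans xs ys us)
  show ?case by (rule free_eq.trans[OF trans.IH])
qed (simp_all add: free_eq.refl free_eq.sym)

lemma free_eq_append_right: "free_eq xs ys \<Longrightarrow> free_eq (xs @ zs) (ys @ zs)"
proof (induction rule: free_eq.induct)
  case (cancel xs g b ys)
  show ?case using free_eq.cancel[of xs g b "ys @ zs"] by simp
next
  case (trans xs ys us)
  show ?case by (rule free_eq.trans[OF trans.IH])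
qed (simp_all add: free_eq.refl free_eq.sym)

lemma free_eq_append: "free_eq xs xs' \<Longrightarrow> free_eq ys ys' \<Longrightarrow> free_eq (xs @ ys) (xs' @ ys')"
  by (rule free_eq.trans[OF free_eq_append_right free_eq_append_left])

lemma free_rel_class_eq_iff: "free_rel `` {xs} = free_rel `` {ys} \<longleftrightarrow> free_eq xs ys"
  using equiv_class_eq_iff[OF equiv_free_rel] by (auto simp: free_rel_def)

lemma free_group_mult_class:
  fixes xs ys :: "'a word"
  shows "free_rel `` {xs} \<otimes>\<^bsub>free_group\<^esub> free_rel `` {ys} = free_rel `` {xs @ ys}"
proof -
  have "free_rel `` {a @ b} = free_rel `` {xs @ ys}"
    if "a \<in> free_rel `` {xs}" "b \<in> free_rel `` {ys}" for a b
    using that unfolding free_rel_class_eq_iff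
    by (simp add: free_rel_def free_eq_append free_eq.sym)
  moreover have "xs \<in> free_rel `` {xs}" "ys \<in> free_rel `` {ys}"
    by (simp_all add: free_rel_def free_eq.refl)
  moreover have "(\<Union>a\<in>A. \<Union>b\<in>B. f a b) = C"
    if "\<And>a b. a \<in> A \<Longrightarrow> b \<in> B \<Longrightarrow> f a b = C" "x \<in> A" "y \<in> B"
    for A B C x y and f :: "'a word \<Rightarrow> 'a word \<Rightarrow> 'a word set"
    using that by blast
  ultimately have "(\<Union>a\<in>free_rel `` {xs}. \<Union>b\<in>free_rel `` {ys}. free_rel `` {a @ b}) = free_rel `` {xs @ ys}"
    by meson
  then show ?thesis
    by (simp only: free_group_def monoid.simps)
qed

lemma carrier_free_group: "carrier free_group = range (\<lambda>xs. free_rel `` {xs})"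
  by (auto simp: free_group_def quotient_def)

lemma one_free_group: "\<one>\<^bsub>free_group\<^esub> = free_rel `` {[]}"
  by (simp add: free_group_def)

lemma free_eq_inverse: "free_eq (rev (map (\<lambda>(g, b). (g, \<not> b)) xs) @ xs) []"
proof (induction xs)
  case Nil
  show ?case by (simp add: free_eq.refl)
next
  case (Cons x xs)
  obtain g b where x: "x = (g, b)" by force
  show ?case
    using free_eq.trans[OF free_eq.cancel[of "rev (map (\<lambda>(g, b). (g, \<not> b)) xs)" g "\<not> b" xs] Cons]
    by (simp add: x)
qed

lemma group_free_group: "group free_group"
proof (rule groupI)
  fix x assume "x \<in> carrier (free_group :: 'a word set monoid)"
  then obtain xs where "x = free_rel `` {xs}" by (auto simp: carrier_free_group)
  then show "\<exists>y\<in>carrier free_group. y \<otimes>\<^bsub>free_group\<^esub> x = \<one>\<^bsub>free_group\<^esub>"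
    using free_eq_inverse[of xs]
    by (auto simp: carrier_free_group free_group_mult_class one_free_group free_rel_class_eq_iff)
qed (auto simp: carrier_free_group one_free_group free_group_mult_class)

definition free_gen :: "'g \<Rightarrow> 'g word set" where
  "free_gen g = free_rel `` {[(g, True)]}"

definition normal_closure :: "('a, 'b) monoid_scheme \<Rightarrow> 'a set \<Rightarrow> 'a set" where
  "normal_closure G S = \<Inter>{N. N \<lhd> G \<and> S \<subseteq> N}"

lemma (in group) normal_closure_normal:
  assumes "S \<subseteq> carrier G"
  shows "normal_closure G S \<lhd> G"
proof -
  have "carrier G \<lhd> G"
    by (simp add: normal_inv_iff subgroup_self)
  then have "\<Inter>{N. N \<lhd> G \<and> S \<subseteq> N} \<lhd> G"
    using assms
    by (intro normal_invI subgroups_Inter) (auto intro: normal_imp_subgroup normal.inv_op_closed2)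
  then show ?thesis
    by (simp add: normal_closure_def)
qed

definition presented_group :: "'g word set set \<Rightarrow> 'g word set set monoid" where
  "presented_group R = free_group Mod (normal_closure free_group R)"


section \<open>The affine group of the line\<close>

definition AGL1 :: "('a, 'b) ring_scheme \<Rightarrow> ('a \<Rightarrow> 'a) monoid" where
  "AGL1 F = BijGroup (carrier F)
     \<lparr>carrier := {\<lambda>x\<in>carrier F. a \<otimes>\<^bsub>F\<^esub> x \<oplus>\<^bsub>F\<^esub> b | a b. a \<in> carrier F - {\<zero>\<^bsub>F\<^esub>} \<and> b \<in> carrier F}\<rparr>"


section \<open>Primitive polynomials\<close>

definition primitive_element :: "('a, 'b) ring_scheme \<Rightarrow> 'a \<Rightarrow> bool" where
  "primitive_element F x \<longleftrightarrow>
     x \<in> carrier (Multiplicative_Group.mult_of F) \<and>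
     generate (Multiplicative_Group.mult_of F) {x} = carrier (Multiplicative_Group.mult_of F)"

text \<open>
  Polynomials are coefficient lists, leading coefficient first.  The prime field is
  \<open>residue_ring p\<close>, whose elements are the integers \<open>0, \<dots>, p - 1\<close>; a coefficient \<open>c\<close> acts on a
  field \<open>F\<close> of characteristic \<open>p\<close> as \<open>c\<close> times the unit of \<open>F\<close>.
\<close>

definition monic_primitive_poly :: "nat \<Rightarrow> nat \<Rightarrow> ('a, 'b) ring_scheme \<Rightarrow> int list \<Rightarrow> bool" where
  "monic_primitive_poly p k F \<mu> \<longleftrightarrow>
     \<mu> \<in> carrier (poly_ring (residue_ring (int p))) \<and>
     pirreducible\<^bsub>residue_ring (int p)\<^esub> (carrier (residue_ring (int p))) \<mu> \<and>
     Polynomials.degree \<mu> = k \<and>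
     Polynomials.lead_coeff \<mu> = \<one>\<^bsub>residue_ring (int p)\<^esub> \<and>
     (\<forall>x\<in>carrier F. ring.eval F (map (\<lambda>c. [c] \<cdot>\<^bsub>F\<^esub> \<one>\<^bsub>F\<^esub>) \<mu>) x = \<zero>\<^bsub>F\<^esub> \<longrightarrow> primitive_element F x)"


section \<open>The relators\<close>

definition commutator :: "('a, 'b) monoid_scheme \<Rightarrow> 'a \<Rightarrow> 'a \<Rightarrow> 'a" where
  "commutator G a b = inv\<^bsub>G\<^esub> a \<otimes>\<^bsub>G\<^esub> inv\<^bsub>G\<^esub> b \<otimes>\<^bsub>G\<^esub> a \<otimes>\<^bsub>G\<^esub> b"

definition list_prod :: "('a, 'b) monoid_scheme \<Rightarrow> 'a list \<Rightarrow> 'a" where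
  "list_prod G xs = foldr (\<otimes>\<^bsub>G\<^esub>) xs \<one>\<^bsub>G\<^esub>"

definition v_q :: "('a, 'b) monoid_scheme \<Rightarrow> nat \<Rightarrow> 'a \<Rightarrow> 'a" where
  "v_q G q v = (if even q then \<one>\<^bsub>G\<^esub> else v [^]\<^bsub>G\<^esub> ((q - 1) div 2))"

definition ell :: "nat \<Rightarrow> nat" where
  "ell q =
     (if q \<in> {2, 3} then q
      else if even q \<or> q mod 4 = 1 then q - 1
      else (q - 1) div 2)"

definition conj_pow :: "('a, 'b) monoid_scheme \<Rightarrow> 'a \<Rightarrow> nat \<Rightarrow> 'a \<Rightarrow> 'a" where
  "conj_pow G v i t = v [^]\<^bsub>G\<^esub> i \<otimes>\<^bsub>G\<^esub> t \<otimes>\<^bsub>G\<^esub> inv\<^bsub>G\<^esub> (v [^]\<^bsub>G\<^esub> i)"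

definition relators ::
  "('a, 'b) monoid_scheme \<Rightarrow> nat \<Rightarrow> nat \<Rightarrow> (nat \<Rightarrow> int) \<Rightarrow> 'a \<Rightarrow> 'a \<Rightarrow> 'a set" where
  "relators G p k a u v =
     (let q = p ^ k; t = u \<otimes>\<^bsub>G\<^esub> v \<otimes>\<^bsub>G\<^esub> v_q G q v in
       {v [^]\<^bsub>G\<^esub> (q - 1), (u \<otimes>\<^bsub>G\<^esub> v) [^]\<^bsub>G\<^esub> (2::nat), u [^]\<^bsub>G\<^esub> ell q, t [^]\<^bsub>G\<^esub> p}
       \<union> {commutator G t (conj_pow G v i t) | i. 1 \<le> i \<and> i \<le> k - 1}
       \<union> {conj_pow G v k t \<otimes>\<^bsub>G\<^esub> list_prod G (map (\<lambda>i. conj_pow G v i t [^]\<^bsub>G\<^esub> a i) [0..<k])})"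

datatype gen = U | V

definition H_group :: "nat \<Rightarrow> nat \<Rightarrow> int list \<Rightarrow> gen word set set monoid" where
  "H_group p k \<mu> =
     presented_group
       (relators free_group p k (ring.coeff (residue_ring (int p)) \<mu>) (free_gen U) (free_gen V))"

end

theory Submission
  imports Defs
begin

text \<open>
  An irreducible \<open>\<mu>\<close> of degree \<open>k\<close> over the prime field divides \<open>X\<^sup>q - X\<close> and hence has a root
  \<open>\<alpha>\<close> in \<open>F\<close>, which is primitive by hypothesis.  With \<open>v\<close> the dilation by \<open>\<alpha>\<close> and \<open>u\<close> the map
  \<open>x \<mapsto> 1 - x / \<alpha>\<close>, the element \<open>t = u v v\<^sub>q\<close> is the translation by \<open>1\<close>, the conjugate
  \<open>v\<^sup>i t v\<^sup>-\<^sup>i\<close> is the translation by \<open>\<alpha>\<^sup>i\<close>, and all relators vanish, so \<open>H\<close> maps onto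
  \<open>AGL(1, q)\<close>.  Conversely, in \<open>H\<close> the commutators and \<open>t\<^sup>p\<close> make the subgroup generated by
  \<open>v\<^sup>i t v\<^sup>-\<^sup>i\<close> for \<open>i < k\<close> elementary abelian of order at most \<open>p\<^sup>k\<close>, and \<open>W\<close> makes it stable under
  conjugation by \<open>v\<close>; hence \<open>H\<close> has at most \<open>q (q - 1)\<close> elements and the map is bijective.
\<close>

section \<open>Bounding the order of a group satisfying the relators\<close>

lemma (in group) nat_pow_mod:
  assumes "x \<in> carrier G" "x [^] (n::nat) = \<one>"
  shows "x [^] (e mod n) = x [^] (e::nat)"
proof -
  have "x [^] e = x [^] (n * (e div n)) \<otimes> x [^] (e mod n)"
    using assms by (simp add: nat_pow_mult)
  also have "x [^] (n * (e div n)) = \<one>"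
    using assms by (simp add: nat_pow_pow [symmetric])
  finally show ?thesis
    using assms by simp
qed

lemma (in group) nat_pow_pred_eq_inv:
  assumes "x \<in> carrier G" "x [^] (n::nat) = \<one>" "n > 0"
  shows "x [^] (n - 1) = inv x"
proof -
  have "x [^] (n - 1) \<otimes> x = x [^] Suc (n - 1)"
    by simp
  also have "\<dots> = \<one>"
    using assms by simp
  finally show ?thesis
    using assms inv_equality by simp
qed

lemma (in group) conj_pow_closed [simp]:
  "v \<in> carrier G \<Longrightarrow> t \<in> carrier G \<Longrightarrow> conj_pow G v i t \<in> carrier G"
  by (simp add: conj_pow_def)

lemma (in group) conj_pow_mult:
  assumes "v \<in> carrier G" "x \<in> carrier G" "y \<in> carrier G"
  shows "conj_pow G v i (x \<otimes> y) = conj_pow G v i x \<otimes> conj_pow G v i y"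
proof -
  have "inv (v [^] i) \<otimes> (v [^] i \<otimes> (y \<otimes> inv (v [^] i))) = y \<otimes> inv (v [^] i)"
    using assms by (simp add: m_assoc [symmetric])
  then show ?thesis
    using assms by (simp add: conj_pow_def m_assoc)
qed

lemma (in group) conj_pow_zero [simp]: "t \<in> carrier G \<Longrightarrow> conj_pow G v 0 t = t"
  by (simp add: conj_pow_def)

lemma (in group) conj_pow_conj_pow:
  assumes "v \<in> carrier G" "t \<in> carrier G"
  shows "conj_pow G v i (conj_pow G v j t) = conj_pow G v (i + j) t"
  using assms by (simp add: conj_pow_def nat_pow_mult [symmetric] inv_mult_group m_assoc)

lemma (in group) conj_pow_hom: "v \<in> carrier G \<Longrightarrow> conj_pow G v i \<in> hom G G"
  by (auto simp: hom_def conj_pow_mult)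

lemma (in group) conj_pow_nat_pow:
  assumes "v \<in> carrier G" "t \<in> carrier G"
  shows "conj_pow G v i (t [^] (n::nat)) = conj_pow G v i t [^] n"
  using assms by (simp add: hom_nat_pow conj_pow_hom is_group)

lemma (in group) conj_pow_one: "v \<in> carrier G \<Longrightarrow> conj_pow G v i \<one> = \<one>"
  by (simp add: conj_pow_def)

lemma (in group) conj_pow_mem:
  assumes "v \<in> carrier G" "A \<subseteq> carrier G"
    and A: "\<And>a. a \<in> A \<Longrightarrow> v \<otimes> a \<otimes> inv v \<in> A" and "a \<in> A"
  shows "conj_pow G v i a \<in> A"
proof (induction i)
  case 0
  then show ?case using assms by auto
next
  case (Suc i)
  have "conj_pow G v (Suc i) a = conj_pow G v 1 (conj_pow G v i a)"
    using assms by (subst conj_pow_conj_pow) auto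
  then show ?case
    using A [OF Suc] assms(1) by (simp add: conj_pow_def)
qed

text \<open>Powers of \<open>x\<close> can be collected on the right, because moving
  \<open>x\<close> past an element of \<open>A\<close> only conjugates that element inside
  \<open>A\<close>. Since \<open>inv x\<close> is \<open>x [^] (n - 1)\<close>, natural exponents
  suffice, and only conjugation by \<open>x\<close>, not by \<open>inv x\<close>, has to preserve
  \<open>A\<close>.\<close>

lemma (in group) generate_cyclic_extension:
  assumes A: "subgroup A G" and S: "S \<subseteq> A" and x: "x \<in> carrier G"
    and n: "x [^] (n::nat) = \<one>" "n > 0"
    and conj: "\<And>a. a \<in> A \<Longrightarrow> x \<otimes> a \<otimes> inv x \<in> A"
  shows "generate G (insert x S) \<subseteq> (\<lambda>(a, e). a \<otimes> x [^] e) ` (A \<times> {..<n})"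
proof -
  have AG: "A \<subseteq> carrier G"
    using A by (rule subgroup.subset)
  have "\<exists>a\<in>A. \<exists>e::nat. g = a \<otimes> x [^] e" if "g \<in> generate G (insert x S)" for g
    using that
  proof (induction rule: generate.induct)
    case one
    then show ?case
      using subgroup.one_closed [OF A] by (intro bexI [of _ \<one>] exI [of _ 0]) auto
  next
    case (incl h)
    show ?case
    proof (cases "h = x")
      case True
      then show ?thesis
        using subgroup.one_closed [OF A] x by (intro bexI [of _ \<one>] exI [of _ 1]) auto
    next
      case False
      then show ?thesis
        using incl S AG by (intro bexI [of _ h] exI [of _ 0]) auto
    qed
  next
    case (inv h)
    show ?case
    proof (cases "h = x")
      case True
      then show ?thesis
        using subgroup.one_closed [OF A] x nat_pow_pred_eq_inv [OF x n]
        by (intro bexI [of _ \<one>] exI [of _ "n - 1"]) auto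
    next
      case False
      then show ?thesis
        using inv S AG subgroup.m_inv_closed [OF A] by (intro bexI [of _ "inv h"] exI [of _ 0]) auto
    qed
  next
    case (eng g h)
    then obtain a b i j where ab: "a \<in> A" "b \<in> A" "g = a \<otimes> x [^] (i::nat)" "h = b \<otimes> x [^] (j::nat)"
      by blast
    \<comment> \<open>Collecting powers:
      \<open>a x^i b x^j = a (x^i b x^-i) x^(i+j)\<close>.\<close>
    have "inv (x [^] i) \<otimes> x [^] (i + j) = x [^] j"
      using x by (simp add: nat_pow_mult [symmetric] m_assoc [symmetric])
    then have "g \<otimes> h = a \<otimes> conj_pow G x i b \<otimes> x [^] (i + j)"
      using ab x subsetD [OF AG] by (simp add: conj_pow_def m_assoc)
    moreover have "a \<otimes> conj_pow G x i b \<in> A"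
      using ab subgroup.m_closed [OF A] conj_pow_mem [OF x AG conj] by simp
    ultimately show ?case
      by blast
  qed
  moreover have "a \<otimes> x [^] e \<in> (\<lambda>(a, e). a \<otimes> x [^] e) ` (A \<times> {..<n})"
    if "a \<in> A" for a and e :: nat
    using that n nat_pow_mod [OF x n(1), of e] by (intro image_eqI [of _ _ "(a, e mod n)"]) auto
  ultimately show ?thesis
    by blast
qed

lemma (in group) card_generate_cyclic_extension_le:
  assumes "subgroup A G" "S \<subseteq> A" "x \<in> carrier G" "x [^] (n::nat) = \<one>" "n > 0"
    and "\<And>a. a \<in> A \<Longrightarrow> x \<otimes> a \<otimes> inv x \<in> A" and "finite A"
  shows "finite (generate G (insert x S))" "card (generate G (insert x S)) \<le> card A * n"
proof -
  let ?B = "(\<lambda>(a, e). a \<otimes> x [^] e) ` (A \<times> {..<n})"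
  have B: "generate G (insert x S) \<subseteq> ?B"
    using assms by (intro generate_cyclic_extension) auto
  have "finite ?B"
    using assms by simp
  then show "finite (generate G (insert x S))"
    using B by (rule rev_finite_subset)
  have "card (generate G (insert x S)) \<le> card ?B"
    using B \<open>finite ?B\<close> by (simp add: card_mono)
  also have "\<dots> \<le> card (A \<times> {..<n})"
    using assms by (intro card_image_le) simp
  finally show "card (generate G (insert x S)) \<le> card A * n"
    by (simp add: card_cartesian_product)
qed

lemma (in group) generate_commutes:
  assumes "g \<in> generate G S" "S \<subseteq> carrier G" "x \<in> carrier G" "\<And>s. s \<in> S \<Longrightarrow> s \<otimes> x = x \<otimes> s"
  shows "g \<otimes> x = x \<otimes> g"
  using assms(1)
proof (induction rule: generate.induct)
  case (inv h)
  then have h: "h \<in> carrier G" "h \<otimes> x = x \<otimes> h"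
    using assms by auto
  then have "h \<otimes> x \<otimes> inv h = x"
    using assms(3) by (simp add: m_assoc)
  then show ?case
    using h(1) assms(3) by (metis inv_closed inv_solve_left m_assoc m_closed)
next
  case (eng g h)
  then have "g \<in> carrier G" "h \<in> carrier G"
    using generate_in_carrier [OF assms(2)] by auto
  then show ?case
    using eng.IH assms(3) by (metis m_assoc)
qed (use assms in auto)

text \<open>Generators are adjoined one at a time. The new one centralizes the group generated so
  far, so the cyclic extension bound applies and contributes a factor of at most
  \<open>n\<close>.\<close>

lemma (in group) card_generate_commuting_le:
  fixes t :: "nat \<Rightarrow> 'a"
  assumes "\<And>i. i < k \<Longrightarrow> t i \<in> carrier G" "\<And>i. i < k \<Longrightarrow> t i [^] (n::nat) = \<one>" "n > 0"
    and "\<And>i j. i < k \<Longrightarrow> j < k \<Longrightarrow> t i \<otimes> t j = t j \<otimes> t i"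
  shows "finite (generate G (t ` {..<k})) \<and> card (generate G (t ` {..<k})) \<le> n ^ k"
  using assms
proof (induction k)
  case 0
  then show ?case
    by (simp add: generate_empty)
next
  case (Suc k)
  let ?S = "t ` {..<k}"
  have SS: "?S \<subseteq> generate G ?S"
    by (auto intro: generate.incl)
  have S: "?S \<subseteq> carrier G" and tk: "t k \<in> carrier G"
    using Suc.prems by auto
  have IH: "finite (generate G ?S)" "card (generate G ?S) \<le> n ^ k"
    using Suc by auto
  have conj: "t k \<otimes> a \<otimes> inv (t k) \<in> generate G ?S" if "a \<in> generate G ?S" for a
  proof -
    have "a \<otimes> t k = t k \<otimes> a"
      using Suc.prems by (intro generate_commutes [OF that S tk]) auto
    then have "t k \<otimes> a \<otimes> inv (t k) = a \<otimes> t k \<otimes> inv (t k)"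
      by simp
    also have "\<dots> = a"
      using generate_in_carrier [OF S that] tk by (simp add: m_assoc)
    finally show ?thesis
      using that by simp
  qed
  have "finite (generate G (insert (t k) ?S))"
       "card (generate G (insert (t k) ?S)) \<le> card (generate G ?S) * n"
    using card_generate_cyclic_extension_le
        [OF generate_is_subgroup [OF S] SS tk _ _ conj IH(1), of n] Suc.prems
    by auto
  moreover have "t ` {..<Suc k} = insert (t k) ?S"
    by (simp add: lessThan_Suc)
  ultimately show ?case
    using order_trans [OF _ mult_le_mono1 [OF IH(2), of n]] by (simp add: mult.commute)
qed

section \<open>The ingredients of the relators and the order bound\<close>

lemma (in subgroup) list_prod_closed: "set xs \<subseteq> H \<Longrightarrow> list_prod G xs \<in> H"
  by (induction xs) (auto simp: list_prod_def)

lemma (in group) v_q_closed [simp]: "v \<in> carrier G \<Longrightarrow> v_q G q v \<in> carrier G"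
  by (simp add: v_q_def)

lemma (in group) subgroup_v_q_closed:
  assumes "subgroup S G" "v \<in> S"
  shows "v_q G q v \<in> S"
  using subgroup_int_pow_closed [OF assms, of "int ((q - 1) div 2)"] subgroup.one_closed [OF assms(1)]
  by (simp add: v_q_def int_pow_int)

text \<open>In this convention the commutator is
  \<open>inv (b \<otimes> a) \<otimes> (a \<otimes> b)\<close>.\<close>

lemma (in group) commutator_eq_one_iff:
  assumes "a \<in> carrier G" "b \<in> carrier G"
  shows "commutator G a b = \<one> \<longleftrightarrow> a \<otimes> b = b \<otimes> a"
proof -
  have "b \<otimes> a \<otimes> commutator G a b = b \<otimes> a \<otimes> (inv (b \<otimes> a) \<otimes> (a \<otimes> b))"
    using assms by (simp add: commutator_def inv_mult_group m_assoc)
  also have "\<dots> = a \<otimes> b"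
    using assms by (simp add: m_assoc [symmetric])
  finally have "b \<otimes> a \<otimes> commutator G a b = a \<otimes> b" .
  moreover have "commutator G a b \<in> carrier G"
    using assms by (simp add: commutator_def)
  ultimately show ?thesis
    using assms l_cancel_one [of "b \<otimes> a" "commutator G a b"] by auto
qed

text \<open>The upper bound for \<open>H\<close>, stated for any generating pair that satisfies the
  relators. With \<open>A\<close> generated by the conjugates \<open>v^i t v^-i\<close> for
  \<open>i < k\<close>, the group is \<open>A\<close> extended by the powers of \<open>v\<close>;
  \<open>A\<close> contributes at most \<open>p ^ k\<close> and \<open>v\<close> at most
  \<open>p ^ k - 1\<close>.\<close>

lemma (in group) card_le_if_relators_trivial:
  assumes u: "u \<in> carrier G" and v: "v \<in> carrier G" and gen: "generate G {u, v} = carrier G"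
    and rel: "relators G p k a u v \<subseteq> {\<one>}" and "p > 1" "k > 0"
  shows "finite (carrier G)" "card (carrier G) \<le> p ^ k * (p ^ k - 1)"
proof -
  let ?q = "p ^ k"
  define t where "t = u \<otimes> v \<otimes> v_q G ?q v"
  have t: "t \<in> carrier G"
    using u v by (simp add: t_def)
  have q: "?q > 1"
    using \<open>p > 1\<close> \<open>k > 0\<close> by (rule one_less_power)
  have vpow: "v [^] (?q - 1) = \<one>" and tp: "t [^] p = \<one>"
    and W: "conj_pow G v k t \<otimes> list_prod G (map (\<lambda>i. conj_pow G v i t [^] a i) [0..<k]) = \<one>"
    and com: "\<And>i. 1 \<le> i \<Longrightarrow> i \<le> k - 1 \<Longrightarrow> commutator G t (conj_pow G v i t) = \<one>"
    using rel unfolding relators_def Let_def t_def [symmetric] by auto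
  let ?t = "\<lambda>i. conj_pow G v i t"
  \<comment> \<open>The relators only make \<open>t\<close> itself commute with the
    \<open>?t j\<close>. Conjugating by \<open>v [^] i\<close> shifts both indices and reaches all
    pairs.\<close>
  have comm: "?t i \<otimes> ?t j = ?t j \<otimes> ?t i" if "i \<le> j" "j < k" for i j
  proof (cases "i = j")
    case False
    then have "commutator G t (?t (j - i)) = \<one>"
      using that by (intro com) auto
    then have "t \<otimes> ?t (j - i) = ?t (j - i) \<otimes> t"
      using t v by (simp add: commutator_eq_one_iff)
    then have "conj_pow G v i (t \<otimes> ?t (j - i)) = conj_pow G v i (?t (j - i) \<otimes> t)"
      by simp
    then show ?thesis
      using t v that by (simp add: conj_pow_mult conj_pow_conj_pow)
  qed simp
  have comm': "?t i \<otimes> ?t j = ?t j \<otimes> ?t i" if "i < k" "j < k" for i j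
    using comm [of i j] comm [of j i] that by (cases "i \<le> j") auto
  let ?A = "generate G (?t ` {..<k})"
  have tG: "?t ` {..<k} \<subseteq> carrier G"
    using t v by auto
  have A: "subgroup ?A G"
    using tG by (rule generate_is_subgroup)
  have "?t i [^] p = \<one>" for i
    using t v tp conj_pow_nat_pow [of v t i p] by (simp add: conj_pow_one)
  then have cardA: "finite ?A" "card ?A \<le> ?q"
    using card_generate_commuting_le [of k ?t p] t v comm' \<open>p > 1\<close> by auto
  have list: "list_prod G (map (\<lambda>i. ?t i [^] a i) [0..<k]) \<in> ?A"
    using generate.incl [of _ "?t ` {..<k}" G]
    by (intro subgroup.list_prod_closed [OF A]) (auto intro!: subgroup_int_pow_closed [OF A])
  \<comment> \<open>\<open>W\<close> makes \<open>?t k\<close> the inverse of a product from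
    \<open>?A\<close>. Thus the shift from \<open>?t i\<close> to \<open>?t (i + 1)\<close> stays in
    \<open>?A\<close> even for \<open>i = k - 1\<close>.\<close>
  have "?t k = inv (list_prod G (map (\<lambda>i. ?t i [^] a i) [0..<k]))"
    using inv_equality [OF W] subgroup.mem_carrier [OF A list] t v by simp
  then have tk: "?t k \<in> ?A"
    using list subgroup.m_inv_closed [OF A] by simp
  have tA: "?t i \<in> ?A" if "i \<le> k" for i
    using that tk by (cases "i = k") (auto intro: generate.incl)
  \<comment> \<open>Conjugation by \<open>v\<close> is an endomorphism, so it suffices to look at
    the generators of \<open>?A\<close>, which it shifts.\<close>
  have conj: "v \<otimes> x \<otimes> inv v \<in> ?A" if "x \<in> ?A" for x
  proof -
    interpret c: group_hom G G "conj_pow G v 1"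
      using v conj_pow_hom by unfold_locales auto
    have "conj_pow G v 1 ` ?A = generate G (conj_pow G v 1 ` ?t ` {..<k})"
      using c.generate_img [OF tG] by simp
    also have "\<dots> \<subseteq> ?A"
      using t v tA by (intro generate_subgroup_incl [OF _ A]) (auto simp: conj_pow_conj_pow)
    finally show ?thesis
      using that v by (auto simp: conj_pow_def)
  qed
  \<comment> \<open>The extension bound needs \<open>v\<close> together with generators of
    \<open>?A\<close>, so \<open>u\<close> has to be recovered: solving the definition of
    \<open>t\<close> expresses it through \<open>t\<close> and \<open>v\<close>.\<close>
  have gen': "generate G (insert v (?t ` {..<k})) = carrier G"
  proof -
    let ?B = "generate G (insert v (?t ` {..<k}))"
    have B: "subgroup ?B G"
      using tG v by (intro generate_is_subgroup) auto
    have vB: "v \<in> ?B"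
      by (simp add: generate.incl)
    have "t = ?t 0"
      using t by simp
    then have tB: "t \<in> ?B"
      using \<open>k > 0\<close> by (metis generate.incl imageI insertI2 lessThan_iff)
    have vqB: "v_q G ?q v \<in> ?B"
      using subgroup_v_q_closed [OF B vB] .
    have "u = t \<otimes> inv (v_q G ?q v) \<otimes> inv v"
      using u v subgroup.mem_carrier [OF B vqB] by (simp add: t_def m_assoc)
    then have "u \<in> ?B"
      using tB vB vqB subgroup.m_closed [OF B] subgroup.m_inv_closed [OF B] by simp
    then have "generate G {u, v} \<subseteq> ?B"
      using vB by (intro generate_subgroup_incl [OF _ B]) auto
    then show ?thesis
      using gen subgroup.subset [OF B] by auto
  qed
  have "finite (carrier G)" "card (carrier G) \<le> card ?A * (?q - 1)"
    using card_generate_cyclic_extension_le [of ?A "?t ` {..<k}" v "?q - 1"] A v vpow q conj cardA(1)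
    unfolding gen' by (auto intro: generate.incl)
  then show "finite (carrier G)" "card (carrier G) \<le> ?q * (?q - 1)"
    using mult_le_mono1 [OF cardA(2), of "?q - 1"] by linarith+
qed

section \<open>Images of the relators under homomorphisms\<close>

lemma (in group_hom) hom_conj_pow:
  "v \<in> carrier G \<Longrightarrow> t \<in> carrier G \<Longrightarrow> h (conj_pow G v i t) = conj_pow H (h v) i (h t)"
  by (simp add: conj_pow_def hom_nat_pow)

lemma (in group_hom) hom_v_q: "v \<in> carrier G \<Longrightarrow> h (v_q G q v) = v_q H q (h v)"
  by (simp add: v_q_def hom_nat_pow)

lemma (in group_hom) hom_commutator:
  "x \<in> carrier G \<Longrightarrow> y \<in> carrier G \<Longrightarrow> h (commutator G x y) = commutator H (h x) (h y)"
  by (simp add: commutator_def)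

lemma (in group_hom) hom_list_prod:
  "set xs \<subseteq> carrier G \<Longrightarrow> h (list_prod G xs) = list_prod H (map h xs)"
proof (induction xs)
  case (Cons x xs)
  then have "list_prod G xs \<in> carrier G"
    using subgroup.list_prod_closed [OF G.subgroup_self] by simp
  then show ?case
    using Cons by (simp add: list_prod_def)
qed (simp add: list_prod_def)

lemma (in group) list_prod_conj_pow_closed:
  "v \<in> carrier G \<Longrightarrow> t \<in> carrier G \<Longrightarrow>
    list_prod G (map (\<lambda>i. conj_pow G v i t [^] (a i :: int)) is) \<in> carrier G"
  by (intro subgroup.list_prod_closed [OF subgroup_self]) auto

lemma (in group) relators_closed:
  "u \<in> carrier G \<Longrightarrow> v \<in> carrier G \<Longrightarrow> relators G p k a u v \<subseteq> carrier G"
  by (auto simp: relators_def Let_def commutator_def list_prod_conj_pow_closed)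

text \<open>Used in both directions of the proof: it carries the relators from the free group to
  \<open>AGL(1, q)\<close>, and also to the quotient \<open>H\<close>.\<close>

lemma (in group_hom) hom_relators:
  assumes "u \<in> carrier G" "v \<in> carrier G"
  shows "h ` relators G p k a u v = relators H p k a (h u) (h v)"
proof -
  define t where "t = u \<otimes> v \<otimes> v_q G (p ^ k) v"
  have t: "t \<in> carrier G"
    using assms by (simp add: t_def)
  have ht: "h t = h u \<otimes>\<^bsub>H\<^esub> h v \<otimes>\<^bsub>H\<^esub> v_q H (p ^ k) (h v)"
    using assms by (simp add: t_def hom_v_q)
  have com: "h ` {commutator G t (conj_pow G v i t) | i. 1 \<le> i \<and> i \<le> k - 1}
      = {commutator H (h t) (conj_pow H (h v) i (h t)) | i. 1 \<le> i \<and> i \<le> k - 1}"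
    using assms t by (auto simp: hom_commutator hom_conj_pow setcompr_eq_image image_image cong: image_cong)
  have "h (list_prod G (map (\<lambda>i. conj_pow G v i t [^] a i) [0..<k]))
      = list_prod H (map h (map (\<lambda>i. conj_pow G v i t [^] a i) [0..<k]))"
    using assms t by (intro hom_list_prod) auto
  also have "map h (map (\<lambda>i. conj_pow G v i t [^] a i) [0..<k])
      = map (\<lambda>i. conj_pow H (h v) i (h t) [^]\<^bsub>H\<^esub> a i) [0..<k]"
    using assms t by (simp add: hom_conj_pow hom_int_pow)
  finally have W: "h (conj_pow G v k t \<otimes> list_prod G (map (\<lambda>i. conj_pow G v i t [^] a i) [0..<k]))
      = conj_pow H (h v) k (h t) \<otimes>\<^bsub>H\<^esub> list_prod H (map (\<lambda>i. conj_pow H (h v) i (h t) [^]\<^bsub>H\<^esub> a i) [0..<k])"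
    using assms t by (simp add: G.list_prod_conj_pow_closed hom_conj_pow)
  show ?thesis
    unfolding relators_def Let_def t_def [symmetric] ht [symmetric] image_Un com
    using assms t by (simp add: W hom_nat_pow)
qed

section \<open>Presented groups\<close>

definition word_eval :: "('a, 'b) monoid_scheme \<Rightarrow> ('g \<Rightarrow> 'a) \<Rightarrow> 'g word \<Rightarrow> 'a" where
  "word_eval G f w = list_prod G (map (\<lambda>(g, b). if b then f g else inv\<^bsub>G\<^esub> f g) w)"

context group
begin

lemma word_eval_closed: "range f \<subseteq> carrier G \<Longrightarrow> word_eval G f w \<in> carrier G"
  unfolding word_eval_def by (intro subgroup.list_prod_closed [OF subgroup_self]) (auto simp: image_subset_iff)

lemma word_eval_append:
  assumes "range f \<subseteq> carrier G"
  shows "word_eval G f (xs @ ys) = word_eval G f xs \<otimes> word_eval G f ys"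
proof (induction xs)
  case Nil
  then show ?case
    using word_eval_closed [OF assms, of ys] by (simp add: word_eval_def list_prod_def)
next
  case (Cons x xs)
  have "(case x of (g, b) \<Rightarrow> if b then f g else inv (f g)) \<in> carrier G"
    using assms by (auto split: prod.split)
  then show ?case
    using Cons word_eval_closed [OF assms]
    by (simp add: word_eval_def list_prod_def m_assoc)
qed

lemma word_eval_cong:
  assumes "free_eq xs ys" "range f \<subseteq> carrier G"
  shows "word_eval G f xs = word_eval G f ys"
  using assms(1)
proof (induction rule: free_eq.induct)
  case (cancel xs g b ys)
  have "f g \<in> carrier G"
    using assms(2) by auto
  then have "word_eval G f [(g, b), (g, \<not> b)] = \<one>"
    by (simp add: word_eval_def list_prod_def)
  then show ?case
    by (simp only: word_eval_append [OF assms(2)] word_eval_closed [OF assms(2)] l_one)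
qed auto

lemma free_group_universal:
  fixes f :: "'c \<Rightarrow> 'a"
  assumes "range f \<subseteq> carrier G"
  obtains h where "h \<in> hom (free_group :: 'c word set monoid) G" "\<And>g. h (free_gen g) = f g"
proof
  let ?h = "\<lambda>A. word_eval G f (SOME w. w \<in> A)"
  \<comment> \<open>\<open>?h\<close> evaluates an arbitrarily chosen word of the class; equivalent
    words have equal values, so the choice does not matter.\<close>
  have h: "?h (free_rel `` {w}) = word_eval G f w" for w
  proof -
    have "(SOME x. x \<in> free_rel `` {w}) \<in> free_rel `` {w}"
      by (rule someI [of _ w]) (simp add: free_rel_def free_eq.refl)
    then show ?thesis
      using word_eval_cong [OF _ assms] by (simp add: free_rel_def)
  qed
  show "?h \<in> hom free_group G"
  proof (rule homI)
    fix x y :: "'c word set"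
    assume "x \<in> carrier free_group" "y \<in> carrier free_group"
    then obtain xs ys where "x = free_rel `` {xs}" "y = free_rel `` {ys}"
      by (auto simp: carrier_free_group)
    then show "?h (x \<otimes>\<^bsub>free_group\<^esub> y) = ?h x \<otimes> ?h y"
      by (simp only: free_group_mult_class h word_eval_append [OF assms])
  qed (rule word_eval_closed [OF assms])
  show "?h (free_gen g) = f g" for g
    unfolding free_gen_def h using assms by (simp add: word_eval_def list_prod_def image_subset_iff)
qed

end

section \<open>Generation of the free group by its letters\<close>

lemma free_gen_closed: "free_gen g \<in> carrier free_group"
  by (auto simp: free_gen_def carrier_free_group)

text \<open>Identifies the class of a negative letter, so that every one-letter word lies in the
  subgroup generated by the \<open>free_gen g\<close>.\<close>

lemma inv_free_gen: "inv\<^bsub>free_group\<^esub> free_gen g = free_rel `` {[(g, False)]}"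
proof -
  interpret group "free_group :: 'a word set monoid"
    by (rule group_free_group)
  have "free_rel `` {[(g, False)]} \<otimes>\<^bsub>free_group\<^esub> free_gen g = \<one>\<^bsub>free_group\<^esub>"
    using free_eq.cancel [of "[]" g False "[]"]
    by (simp add: free_gen_def free_group_mult_class one_free_group free_rel_class_eq_iff)
  then show ?thesis
    using inv_equality [OF _ free_gen_closed] by (auto simp: carrier_free_group)
qed

lemma generate_free_gen:
  "generate free_group (range free_gen) = carrier (free_group :: 'a word set monoid)"
  (is "?L = ?R")
proof
  show "?L \<subseteq> ?R"
    by (intro group.generate_incl group_free_group image_subsetI free_gen_closed)
  have "free_rel `` {w} \<in> generate free_group (range free_gen)" for w :: "'a word"
  proof (induction w)
    case Nil
    then show ?case
      by (metis generate.one one_free_group)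
  next
    case (Cons x w)
    obtain g b where x: "x = (g, b)"
      by force
    have "free_rel `` {[x]} \<in> generate free_group (range free_gen)"
    proof (cases b)
      case True
      then show ?thesis
        by (metis free_gen_def generate.incl rangeI x)
    next
      case False
      then show ?thesis
        by (metis inv_free_gen generate.inv rangeI x)
    qed
    then show ?case
      using generate.eng [OF _ Cons] free_group_mult_class [of "[x]" w] by fastforce
  qed
  then show "?R \<subseteq> ?L"
    unfolding carrier_free_group by (rule image_subsetI)
qed

section \<open>Normal closures and the quotient by the relators\<close>

lemma subset_normal_closure: "S \<subseteq> normal_closure G S"
  by (auto simp: normal_closure_def)

lemma normal_closure_subset: "N \<lhd> G \<Longrightarrow> S \<subseteq> N \<Longrightarrow> normal_closure G S \<subseteq> N"
  by (auto simp: normal_closure_def)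

lemma group_presented_group:
  "R \<subseteq> carrier free_group \<Longrightarrow> group (presented_group R)"
  unfolding presented_group_def
  by (intro normal.factorgroup_is_group group.normal_closure_normal group_free_group)

definition presented_gen :: "'g word set set \<Rightarrow> 'g \<Rightarrow> 'g word set set" where
  "presented_gen R g = normal_closure free_group R #>\<^bsub>free_group\<^esub> free_gen g"

lemma presented_group_proj:
  assumes "R \<subseteq> carrier free_group"
  shows "group_hom free_group (presented_group R) ((#>\<^bsub>free_group\<^esub>) (normal_closure free_group R))"
  using normal.r_coset_hom_Mod [OF group.normal_closure_normal [OF group_free_group assms]]
    group_presented_group [OF assms] group_free_group
  by (simp add: group_hom_def group_hom_axioms_def presented_group_def)

lemma presented_group_relator:
  assumes "R \<subseteq> carrier free_group" "r \<in> R"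
  shows "normal_closure free_group R #>\<^bsub>free_group\<^esub> r = \<one>\<^bsub>presented_group R\<^esub>"
proof -
  have "subgroup (normal_closure free_group R) free_group"
    using group.normal_closure_normal [OF group_free_group assms(1)] normal_imp_subgroup by blast
  then show ?thesis
    using subgroup.rcos_const [OF _ group_free_group subsetD [OF subset_normal_closure assms(2)]]
    by (simp add: presented_group_def)
qed

lemma generate_presented_gen:
  assumes "R \<subseteq> carrier free_group"
  shows "generate (presented_group R) (range (presented_gen R)) = carrier (presented_group R)"
proof -
  interpret group_hom free_group "presented_group R" "(#>\<^bsub>free_group\<^esub>) (normal_closure free_group R)"
    using assms by (rule presented_group_proj)
  have "range (presented_gen R) = (#>\<^bsub>free_group\<^esub>) (normal_closure free_group R) ` range free_gen"
    by (auto simp: presented_gen_def)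
  then have "generate (presented_group R) (range (presented_gen R))
      = (#>\<^bsub>free_group\<^esub>) (normal_closure free_group R) ` generate free_group (range free_gen)"
    using generate_img [of "range free_gen", OF image_subsetI [OF free_gen_closed]] by simp
  also have "\<dots> = carrier (presented_group R)"
    by (simp add: generate_free_gen presented_group_def carrier_FactGroup)
  finally show ?thesis .
qed

text \<open>The kernel of \<open>h\<close> is normal and contains \<open>R\<close>, hence contains
  the normal closure. So \<open>h\<close> is constant on cosets and factors through the
  quotient.\<close>

lemma (in group) presented_group_universal:
  assumes R: "R \<subseteq> carrier free_group" and h: "h \<in> hom free_group G" and hR: "h ` R \<subseteq> {\<one>}"
  obtains g where "g \<in> hom (presented_group R) G" "\<And>x. g (presented_gen R x) = h (free_gen x)"
proof -
  interpret h: group_hom free_group G h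
    using h group_free_group is_group by (simp add: group_hom_def group_hom_axioms_def)
  let ?N = "normal_closure free_group R"
  have N: "?N \<lhd> free_group"
    using R by (rule h.G.normal_closure_normal)
  have ker: "?N \<subseteq> kernel free_group G h"
    using R hR by (intro normal_closure_subset h.normal_kernel) (auto simp: kernel_def)
  have "h x = h y" if "x \<in> carrier free_group" "y \<in> carrier free_group"
    and eq: "?N #>\<^bsub>free_group\<^esub> x = ?N #>\<^bsub>free_group\<^esub> y" for x y
  proof -
    have "x \<in> ?N #>\<^bsub>free_group\<^esub> y"
      using h.G.rcos_self [OF that(1) normal_imp_subgroup [OF N]] eq by simp
    then obtain n where "n \<in> ?N" "x = n \<otimes>\<^bsub>free_group\<^esub> y"
      by (auto simp: r_coset_def)
    then show ?thesis
      using ker that by (auto simp: kernel_def)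
  qed
  then obtain g where "g \<in> hom (free_group Mod ?N) G"
    "\<And>x. x \<in> carrier free_group \<Longrightarrow> g (?N #>\<^bsub>free_group\<^esub> x) = h x"
    using FactGroup_universal [OF h N] by blast
  then show ?thesis
    using that [of g] by (auto simp: presented_group_def presented_gen_def free_gen_closed)
qed

section \<open>The affine group\<close>

text \<open>The restriction to the carrier makes the map extensional, as membership in
  \<open>Bij\<close> demands.\<close>

definition affine_map :: "('a, 'b) ring_scheme \<Rightarrow> 'a \<Rightarrow> 'a \<Rightarrow> 'a \<Rightarrow> 'a" where
  "affine_map R a b = (\<lambda>x\<in>carrier R. a \<otimes>\<^bsub>R\<^esub> x \<oplus>\<^bsub>R\<^esub> b)"

context field
begin

section \<open>The group structure on affine maps\<close>

lemma nonzero_inv: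
  assumes "a \<in> carrier R - {\<zero>}"
  shows "inv a \<in> carrier R - {\<zero>}" "inv a \<otimes> a = \<one>" "a \<otimes> inv a = \<one>"
  using assms field_Units Units_inv_closed Units_l_inv Units_r_inv
  by (auto simp: Units_inv_Units)

lemma affine_map_Bij:
  assumes "a \<in> carrier R - {\<zero>}" "b \<in> carrier R"
  shows "affine_map R a b \<in> Bij (carrier R)"
proof -
  have "bij_betw (affine_map R a b) (carrier R) (carrier R)"
  proof (rule bij_betw_byWitness [where f' = "\<lambda>x. inv a \<otimes> (x \<ominus> b)"])
    show "\<forall>x\<in>carrier R. inv a \<otimes> (affine_map R a b x \<ominus> b) = x"
    proof
      fix x assume x: "x \<in> carrier R"
      then have "inv a \<otimes> (affine_map R a b x \<ominus> b) = inv a \<otimes> a \<otimes> x"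
        using assms nonzero_inv(1) [OF assms(1)] unfolding affine_map_def by simp algebra
      then show "inv a \<otimes> (affine_map R a b x \<ominus> b) = x"
        using x nonzero_inv(2) [OF assms(1)] by simp
    qed
    show "\<forall>y\<in>carrier R. affine_map R a b (inv a \<otimes> (y \<ominus> b)) = y"
    proof
      fix y assume y: "y \<in> carrier R"
      then have "affine_map R a b (inv a \<otimes> (y \<ominus> b)) = a \<otimes> inv a \<otimes> (y \<ominus> b) \<oplus> b"
        using assms nonzero_inv(1) [OF assms(1)] by (simp add: affine_map_def m_assoc)
      also have "\<dots> = y"
        using y assms(2) nonzero_inv(3) [OF assms(1)] by simp algebra
      finally show "affine_map R a b (inv a \<otimes> (y \<ominus> b)) = y" .
    qed
  qed (use assms nonzero_inv(1) [OF assms(1)] in \<open>auto simp: affine_map_def\<close>)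
  then show ?thesis
    by (simp add: Bij_def affine_map_def)
qed

lemma carrier_AGL1:
  "carrier (AGL1 R) = (\<lambda>(a, b). affine_map R a b) ` ((carrier R - {\<zero>}) \<times> carrier R)"
  by (auto simp: AGL1_def affine_map_def)

lemma affine_map_closed:
  "a \<in> carrier R - {\<zero>} \<Longrightarrow> b \<in> carrier R \<Longrightarrow> affine_map R a b \<in> carrier (AGL1 R)"
  by (auto simp: carrier_AGL1)

lemma one_AGL1: "\<one>\<^bsub>AGL1 R\<^esub> = affine_map R \<one> \<zero>"
  by (auto simp: AGL1_def BijGroup_def affine_map_def)

lemma mult_AGL1:
  assumes "a \<in> carrier R - {\<zero>}" "b \<in> carrier R" "c \<in> carrier R - {\<zero>}" "d \<in> carrier R"
  shows "affine_map R a b \<otimes>\<^bsub>AGL1 R\<^esub> affine_map R c d = affine_map R (a \<otimes> c) (a \<otimes> d \<oplus> b)"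
proof -
  have "affine_map R a b \<otimes>\<^bsub>AGL1 R\<^esub> affine_map R c d
      = compose (carrier R) (affine_map R a b) (affine_map R c d)"
    using affine_map_Bij assms by (simp add: AGL1_def BijGroup_def)
  also have "\<dots> = affine_map R (a \<otimes> c) (a \<otimes> d \<oplus> b)"
  proof
    fix x
    show "compose (carrier R) (affine_map R a b) (affine_map R c d) x
        = affine_map R (a \<otimes> c) (a \<otimes> d \<oplus> b) x"
    proof (cases "x \<in> carrier R")
      case True
      have "a \<otimes> (c \<otimes> x \<oplus> d) \<oplus> b = a \<otimes> c \<otimes> x \<oplus> (a \<otimes> d \<oplus> b)"
        using assms True by (simp add: r_distr m_assoc a_assoc)
      then show ?thesis
        using assms True by (simp add: compose_def affine_map_def)
    qed (simp add: compose_def affine_map_def)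
  qed
  finally show ?thesis .
qed

text \<open>The image of \<open>\<zero>\<close> determines the translation part, and then the image
  of \<open>\<one>\<close> the factor.\<close>

lemma affine_map_eq_iff:
  assumes "a \<in> carrier R" "b \<in> carrier R" "c \<in> carrier R" "d \<in> carrier R"
  shows "affine_map R a b = affine_map R c d \<longleftrightarrow> a = c \<and> b = d"
proof
  assume eq: "affine_map R a b = affine_map R c d"
  have "b = d"
    using fun_cong [OF eq, of \<zero>] assms by (simp add: affine_map_def)
  moreover have "a = c"
    using fun_cong [OF eq, of \<one>] assms \<open>b = d\<close> by (simp add: affine_map_def)
  ultimately show "a = c \<and> b = d"
    by simp
qed simp

lemma nonzero_mult_closed:
  "a \<in> carrier R - {\<zero>} \<Longrightarrow> b \<in> carrier R - {\<zero>} \<Longrightarrow> a \<otimes> b \<in> carrier R - {\<zero>}"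
  using integral by auto

lemma group_AGL1: "group (AGL1 R)"
proof (rule groupI)
  fix x y z assume "x \<in> carrier (AGL1 R)" "y \<in> carrier (AGL1 R)" "z \<in> carrier (AGL1 R)"
  then obtain r s t where "r \<in> (carrier R - {\<zero>}) \<times> carrier R" "s \<in> (carrier R - {\<zero>}) \<times> carrier R"
    "t \<in> (carrier R - {\<zero>}) \<times> carrier R" "x = (\<lambda>(a, b). affine_map R a b) r"
    "y = (\<lambda>(a, b). affine_map R a b) s" "z = (\<lambda>(a, b). affine_map R a b) t"
    unfolding carrier_AGL1 by blast
  moreover obtain a b c d e f where "r = (a, b)" "s = (c, d)" "t = (e, f)"
    by (metis surj_pair)
  ultimately have *: "x = affine_map R a b" "y = affine_map R c d" "z = affine_map R e f"
    "a \<in> carrier R - {\<zero>}" "b \<in> carrier R" "c \<in> carrier R - {\<zero>}" "d \<in> carrier R"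
    "e \<in> carrier R - {\<zero>}" "f \<in> carrier R"
    by simp_all
  then show "x \<otimes>\<^bsub>AGL1 R\<^esub> y \<otimes>\<^bsub>AGL1 R\<^esub> z = x \<otimes>\<^bsub>AGL1 R\<^esub> (y \<otimes>\<^bsub>AGL1 R\<^esub> z)"
    using nonzero_mult_closed [OF *(4,6)] nonzero_mult_closed [OF *(6,8)]
    by (simp add: mult_AGL1 m_assoc r_distr a_assoc)
next
  fix x y assume "x \<in> carrier (AGL1 R)" "y \<in> carrier (AGL1 R)"
  then obtain r s where "r \<in> (carrier R - {\<zero>}) \<times> carrier R" "s \<in> (carrier R - {\<zero>}) \<times> carrier R"
    "x = (\<lambda>(a, b). affine_map R a b) r" "y = (\<lambda>(a, b). affine_map R a b) s"
    unfolding carrier_AGL1 by blast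
  moreover obtain a b c d where "r = (a, b)" "s = (c, d)"
    by (metis surj_pair)
  ultimately show "x \<otimes>\<^bsub>AGL1 R\<^esub> y \<in> carrier (AGL1 R)"
    using nonzero_mult_closed [of a c] by (simp add: mult_AGL1 affine_map_closed)
next
  fix x assume "x \<in> carrier (AGL1 R)"
  then obtain a b where x: "x = affine_map R a b" "a \<in> carrier R - {\<zero>}" "b \<in> carrier R"
    by (auto simp: carrier_AGL1)
  then show "\<one>\<^bsub>AGL1 R\<^esub> \<otimes>\<^bsub>AGL1 R\<^esub> x = x"
    by (simp add: one_AGL1 mult_AGL1)
  have "affine_map R (inv a) (\<ominus> (inv a \<otimes> b)) \<otimes>\<^bsub>AGL1 R\<^esub> x = \<one>\<^bsub>AGL1 R\<^esub>"
    using x nonzero_inv [OF x(2)] by (simp add: one_AGL1 mult_AGL1 r_neg)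
  then show "\<exists>y\<in>carrier (AGL1 R). y \<otimes>\<^bsub>AGL1 R\<^esub> x = \<one>\<^bsub>AGL1 R\<^esub>"
    using x nonzero_inv(1) [OF x(2)]
    by (intro bexI [of _ "affine_map R (inv a) (\<ominus> (inv a \<otimes> b))"] affine_map_closed) simp_all
qed (simp add: one_AGL1 affine_map_closed)

lemma card_AGL1: "card (carrier (AGL1 R)) = card (carrier R) * (card (carrier R) - 1)"
proof -
  have "inj_on (\<lambda>(a, b). affine_map R a b) ((carrier R - {\<zero>}) \<times> carrier R)"
    by (auto simp: inj_on_def affine_map_eq_iff)
  then show ?thesis
    by (simp add: carrier_AGL1 card_image card_cartesian_product card_Diff_singleton)
qed

sublocale AGL1: group "AGL1 R"
  by (rule group_AGL1)

section \<open>Translations, dilations and their powers\<close>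

lemma translation_hom: "group_hom (add_monoid R) (AGL1 R) (affine_map R \<one>)"
  using a_group AGL1.is_group
  by (auto simp: group_hom_def group_hom_axioms_def hom_def affine_map_closed mult_AGL1 a_comm)

lemma dilation_hom: "group_hom (Multiplicative_Group.mult_of R) (AGL1 R) (\<lambda>a. affine_map R a \<zero>)"
  using field_mult_group AGL1.is_group
  by (auto simp: group_hom_def group_hom_axioms_def hom_def affine_map_closed mult_AGL1)

lemma translation_nat_pow:
  "b \<in> carrier R \<Longrightarrow> affine_map R \<one> b [^]\<^bsub>AGL1 R\<^esub> (n::nat) = affine_map R \<one> ([n] \<cdot> b)"
  using group_hom.hom_nat_pow [OF translation_hom, of b n] by (simp add: add_pow_def)

lemma translation_int_pow:
  "b \<in> carrier R \<Longrightarrow> affine_map R \<one> b [^]\<^bsub>AGL1 R\<^esub> (n::int) = affine_map R \<one> ([n] \<cdot> b)"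
  using group_hom.hom_int_pow [OF translation_hom, of b n] by (simp add: add_pow_def)

lemma dilation_nat_pow:
  "a \<in> carrier R - {\<zero>} \<Longrightarrow> affine_map R a \<zero> [^]\<^bsub>AGL1 R\<^esub> (n::nat) = affine_map R (a [^] n) \<zero>"
  using group_hom.hom_nat_pow [OF dilation_hom, of a n] by (simp add: Multiplicative_Group.nat_pow_mult_of)

lemma inv_dilation:
  assumes "a \<in> carrier R - {\<zero>}"
  shows "inv\<^bsub>AGL1 R\<^esub> affine_map R a \<zero> = affine_map R (inv a) \<zero>"
  using assms nonzero_inv [OF assms] affine_map_closed
  by (intro AGL1.inv_equality) (auto simp: mult_AGL1 one_AGL1)

lemma nonzero_pow_closed: "a \<in> carrier R - {\<zero>} \<Longrightarrow> a [^] (n::nat) \<in> carrier R - {\<zero>}"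
  using monoid.nat_pow_closed [OF group.is_monoid [OF field_mult_group], of a n]
  by (simp add: Multiplicative_Group.nat_pow_mult_of)

text \<open>The dilation and its inverse cancel in the linear part and leave the translation part
  scaled. This is how \<open>W\<close> turns into the value of a polynomial.\<close>

lemma conj_pow_translation:
  assumes "a \<in> carrier R - {\<zero>}" "b \<in> carrier R"
  shows "conj_pow (AGL1 R) (affine_map R a \<zero>) i (affine_map R \<one> b) = affine_map R \<one> (a [^] i \<otimes> b)"
  using assms nonzero_inv [OF nonzero_pow_closed [OF assms(1)], of i] nonzero_pow_closed [OF assms(1), of i]
  by (simp add: conj_pow_def dilation_nat_pow inv_dilation mult_AGL1)

text \<open>For \<open>c \<noteq> \<one>\<close> the map has a fixed point, so it is conjugate to
  the dilation by \<open>c\<close> and has the same order. The proof replaces the fixed point by an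
  identity for the translation parts of the powers.\<close>

lemma affine_map_pow_eq_one:
  assumes c: "c \<in> carrier R - {\<zero>}" "c \<noteq> \<one>" and d: "d \<in> carrier R" and n: "c [^] (n::nat) = \<one>"
  shows "affine_map R c d [^]\<^bsub>AGL1 R\<^esub> n = \<one>\<^bsub>AGL1 R\<^esub>"
proof -
  \<comment> \<open>\<open>e\<close> is the geometric sum \<open>(1 + c + ... + c^(m-1)) d\<close>;
    multiplying it by \<open>\<one> \<ominus> c\<close> telescopes and avoids division.\<close>
  have "\<exists>e\<in>carrier R. affine_map R c d [^]\<^bsub>AGL1 R\<^esub> m = affine_map R (c [^] m) e
      \<and> (\<one> \<ominus> c) \<otimes> e = (\<one> \<ominus> c [^] m) \<otimes> d" for m :: nat
  proof (induction m)
    case 0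
    show ?case
      using c d by (intro bexI [of _ \<zero>]) (auto simp: one_AGL1 minus_eq r_neg)
  next
    case (Suc m)
    then obtain e where e: "e \<in> carrier R" "affine_map R c d [^]\<^bsub>AGL1 R\<^esub> m = affine_map R (c [^] m) e"
      "(\<one> \<ominus> c) \<otimes> e = (\<one> \<ominus> c [^] m) \<otimes> d"
      by blast
    have cm: "c [^] m \<in> carrier R"
      using c by simp
    have "(\<one> \<ominus> c) \<otimes> (c [^] m \<otimes> d \<oplus> e) = (\<one> \<ominus> c) \<otimes> (c [^] m \<otimes> d) \<oplus> (\<one> \<ominus> c) \<otimes> e"
      using c(1) d e(1) cm by (simp add: r_distr)
    also have "\<dots> = (\<one> \<ominus> c [^] m \<otimes> c) \<otimes> d"
    proof -
      have "c \<in> carrier R"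
        using c by simp
      then show ?thesis
        unfolding e(3) using d cm by algebra
    qed
    finally have "(\<one> \<ominus> c) \<otimes> (c [^] m \<otimes> d \<oplus> e) = (\<one> \<ominus> c [^] Suc m) \<otimes> d"
      by simp
    moreover have "affine_map R c d [^]\<^bsub>AGL1 R\<^esub> Suc m = affine_map R (c [^] Suc m) (c [^] m \<otimes> d \<oplus> e)"
      using nonzero_pow_closed [OF c(1), of m] c(1) d e by (simp add: mult_AGL1)
    ultimately show ?case
      using cm d e by blast
  qed
  \<comment> \<open>At \<open>m = n\<close> the right side vanishes while
    \<open>\<one> \<ominus> c\<close> is nonzero, so no translation part remains.\<close>
  then obtain e where e: "e \<in> carrier R" "affine_map R c d [^]\<^bsub>AGL1 R\<^esub> n = affine_map R \<one> e"
    "(\<one> \<ominus> c) \<otimes> e = \<zero>"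
    using n d by (metis r_right_minus_eq one_closed l_null)
  moreover have "\<one> \<ominus> c \<noteq> \<zero>"
    using c by auto
  ultimately have "e = \<zero>"
    using c integral [of "\<one> \<ominus> c" e] by auto
  then show ?thesis
    using e by (simp add: one_AGL1)
qed

text \<open>Every affine map is a dilation followed by a translation. Dilations are powers of the
  given one because \<open>\<alpha>\<close> is primitive, and the translation by a nonzero
  \<open>b\<close> is the conjugate of the translation by \<open>\<one>\<close> under the dilation
  by \<open>b\<close>.\<close>

lemma generate_AGL1:
  assumes fin: "finite (carrier R)" and prim: "primitive_element R \<alpha>"
  shows "generate (AGL1 R) {affine_map R \<one> \<one>, affine_map R \<alpha> \<zero>} = carrier (AGL1 R)"
proof -
  let ?t = "affine_map R \<one> \<one>" and ?v = "affine_map R \<alpha> \<zero>"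
  have \<alpha>: "\<alpha> \<in> carrier R - {\<zero>}"
    using prim by (simp add: primitive_element_def)
  have tv: "{?t, ?v} \<subseteq> carrier (AGL1 R)"
    using \<alpha> affine_map_closed by auto
  let ?S = "generate (AGL1 R) {?t, ?v}"
  have S: "subgroup ?S (AGL1 R)"
    using tv by (rule AGL1.generate_is_subgroup)
  interpret mult: group "Multiplicative_Group.mult_of R"
    by (rule field_mult_group)
  have dil: "affine_map R a \<zero> \<in> ?S" if "a \<in> carrier R - {\<zero>}" for a
  proof -
    have "a \<in> generate (Multiplicative_Group.mult_of R) {\<alpha>}"
      using prim that by (simp add: primitive_element_def)
    then obtain j :: nat where "a = \<alpha> [^] j"
      using mult.generate_pow_on_finite_carrier [of \<alpha>] \<alpha> fin
      by (auto simp: Multiplicative_Group.nat_pow_mult_of)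
    then have "affine_map R a \<zero> = ?v [^]\<^bsub>AGL1 R\<^esub> int j"
      using \<alpha> by (simp add: dilation_nat_pow int_pow_int)
    then show ?thesis
      using AGL1.subgroup_int_pow_closed [OF S] by (simp add: generate.incl)
  qed
  have trans: "affine_map R \<one> b \<in> ?S" if "b \<in> carrier R" for b
  proof (cases "b = \<zero>")
    case True
    then show ?thesis
      using generate.one [of "AGL1 R"] by (simp add: one_AGL1)
  next
    case False
    then have "affine_map R \<one> b = affine_map R b \<zero> \<otimes>\<^bsub>AGL1 R\<^esub> ?t \<otimes>\<^bsub>AGL1 R\<^esub> affine_map R (inv b) \<zero>"
      using that nonzero_inv [of b] by (simp add: mult_AGL1)
    also have "\<dots> \<in> ?S"
      using that False nonzero_inv [of b] by (intro generate.eng dil generate.incl) auto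
    finally show ?thesis .
  qed
  have "affine_map R a b \<in> ?S" if "a \<in> carrier R - {\<zero>}" "b \<in> carrier R" for a b
  proof -
    have "affine_map R a b = affine_map R \<one> b \<otimes>\<^bsub>AGL1 R\<^esub> affine_map R a \<zero>"
      using that by (simp add: mult_AGL1)
    then show ?thesis
      using that generate.eng [OF trans dil] by simp
  qed
  then show ?thesis
    using subgroup.subset [OF S] by (auto simp: carrier_AGL1)
qed

text \<open>Translations compose by adding their vectors. Coefficient lists begin with the leading
  coefficient whereas the product begins at \<open>i = 0\<close>, hence the
  \<open>rev\<close>.\<close>

lemma list_prod_translations:
  assumes "\<alpha> \<in> carrier R"
  shows "list_prod (AGL1 R) (map (\<lambda>i. affine_map R \<one> ([(a i :: int)] \<cdot> (\<alpha> [^] i))) [0..<n])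
    = affine_map R \<one> (eval (map (\<lambda>c. [c] \<cdot> \<one>) (map a (rev [0..<n]))) \<alpha>)"
proof (induction n)
  case 0
  then show ?case
    by (simp add: list_prod_def one_AGL1)
next
  case (Suc n)
  \<comment> \<open>\<open>list_prod\<close> unfolds from the head, but the induction on
    \<open>n\<close> adds a factor at the end.\<close>
  have append: "list_prod (AGL1 R) (xs @ [x]) = list_prod (AGL1 R) xs \<otimes>\<^bsub>AGL1 R\<^esub> x"
    if "set xs \<subseteq> carrier (AGL1 R)" "x \<in> carrier (AGL1 R)" for xs x
    using that
  proof (induction xs)
    case (Cons y ys)
    then show ?case
      using subgroup.list_prod_closed [OF AGL1.subgroup_self, of ys]
      by (simp add: list_prod_def AGL1.m_assoc)
  qed (simp add: list_prod_def)
  let ?e = "eval (map (\<lambda>c. [c] \<cdot> \<one>) (map a (rev [0..<n]))) \<alpha>"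
  have e: "?e \<in> carrier R"
    using assms by (intro eval_in_carrier) auto
  have "list_prod (AGL1 R) (map (\<lambda>i. affine_map R \<one> ([a i] \<cdot> (\<alpha> [^] i))) [0..<Suc n])
      = affine_map R \<one> ?e \<otimes>\<^bsub>AGL1 R\<^esub> affine_map R \<one> ([a n] \<cdot> (\<alpha> [^] n))"
    unfolding upt_Suc_append [OF le0] map_append list.map Suc.IH [symmetric]
    using assms by (intro append) (auto intro!: affine_map_closed)
  also have "\<dots> = affine_map R \<one> ([a n] \<cdot> (\<alpha> [^] n) \<oplus> ?e)"
    using assms e by (simp add: mult_AGL1)
  also have "[a n] \<cdot> (\<alpha> [^] n) \<oplus> ?e = eval (map (\<lambda>c. [c] \<cdot> \<one>) (map a (rev [0..<Suc n]))) \<alpha>"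
    using assms by (simp add: add_pow_ldistr_int)
  finally show ?case .
qed

section \<open>Arithmetic in the finite field\<close>

lemma char_eq_zero:
  assumes "card (carrier R) = p ^ k"
  shows "[p] \<cdot> \<one> = \<zero>"
proof -
  \<comment> \<open>By Lagrange in the additive group, \<open>p ^ k\<close> times
    \<open>\<one>\<close> is zero. So \<open>[p] \<cdot> \<one>\<close> is nilpotent and vanishes in
    a field.\<close>
  have pow: "([p] \<cdot> \<one>) [^] n = [(p ^ n)] \<cdot> \<one>" for n :: nat
  proof (induction n)
    case (Suc n)
    then show ?case
      by (simp add: add_pow_ldistr add.nat_pow_pow)
  qed (simp add: add.nat_pow_eone)
  have "[(p ^ k)] \<cdot> \<one> = \<zero>"
    using group.pow_order_eq_1 [OF a_group, of \<one>] assms by (simp add: order_def add_pow_def)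
  then have "([p] \<cdot> \<one>) [^] k = \<zero>"
    by (simp add: pow)
  then show ?thesis
    using nonzero_pow_closed [of "[p] \<cdot> \<one>" k] by auto
qed

lemma nonzero_pow_card_pred:
  assumes "finite (carrier R)" "a \<in> carrier R - {\<zero>}"
  shows "a [^] (card (carrier R) - 1) = \<one>"
  using group.pow_order_eq_1 [OF field_mult_group, of a] assms
  by (simp add: order_def card_Diff_singleton Multiplicative_Group.nat_pow_mult_of)

lemma primitive_element_pow_eq_one_iff:
  assumes "finite (carrier R)" "primitive_element R \<alpha>"
  shows "\<alpha> [^] (n::nat) = \<one> \<longleftrightarrow> (card (carrier R) - 1) dvd n"
proof -
  interpret mult: group "Multiplicative_Group.mult_of R"
    by (rule field_mult_group)
  have \<alpha>: "\<alpha> \<in> carrier (Multiplicative_Group.mult_of R)"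
    using assms by (simp add: primitive_element_def)
  have "mult.ord \<alpha> = card (carrier R) - 1"
    using mult.generate_pow_card [OF \<alpha>] assms
    by (simp add: primitive_element_def card_Diff_singleton)
  then show ?thesis
    using mult.pow_eq_id [OF \<alpha>, of n] by (simp add: Multiplicative_Group.nat_pow_mult_of)
qed

text \<open>The power squares to \<open>\<one>\<close> but, by the order of \<open>\<alpha>\<close>,
  is not \<open>\<one>\<close>; in a field only \<open>\<ominus> \<one>\<close> is left.\<close>

lemma primitive_element_pow_half:
  assumes "finite (carrier R)" "primitive_element R \<alpha>" "odd (card (carrier R))" "card (carrier R) > 1"
  shows "\<alpha> [^] ((card (carrier R) - 1) div 2) = \<ominus> \<one>"
proof -
  let ?m = "(card (carrier R) - 1) div 2"
  have \<alpha>: "\<alpha> \<in> carrier R"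
    using assms by (simp add: primitive_element_def)
  have m: "?m * 2 = card (carrier R) - 1" "?m > 0"
    using assms by (auto elim!: oddE)
  then have "\<alpha> [^] ?m \<otimes> \<alpha> [^] ?m = \<one>"
    using primitive_element_pow_eq_one_iff [OF assms(1,2), of "?m + ?m"] \<alpha>
    by (simp add: nat_pow_mult mult_2_right)
  then have "(\<alpha> [^] ?m \<ominus> \<one>) \<otimes> (\<alpha> [^] ?m \<oplus> \<one>) = \<zero>"
    using \<alpha> nat_pow_closed [OF \<alpha>, of ?m] by algebra
  moreover have "\<not> card (carrier R) - 1 dvd ?m"
    using m by (auto dest: dvd_imp_le)
  then have "\<alpha> [^] ?m \<noteq> \<one>"
    using primitive_element_pow_eq_one_iff [OF assms(1,2)] by simp
  ultimately have "\<alpha> [^] ?m \<oplus> \<one> = \<zero>"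
    using \<alpha> integral [of "\<alpha> [^] ?m \<ominus> \<one>" "\<alpha> [^] ?m \<oplus> \<one>"] by auto
  then show ?thesis
    using \<alpha> by (simp add: minus_equality)
qed

lemma minus_one_pow_odd: "odd (n::nat) \<Longrightarrow> (\<ominus> \<one>) [^] n = \<ominus> \<one>"
proof (elim oddE)
  fix m assume n: "n = 2 * m + 1"
  have "(\<ominus> \<one>) [^] (2::nat) = \<one>"
    by (simp add: numeral_2_eq_2 l_minus)
  then have "(\<ominus> \<one>) [^] (2 * m) = \<one>"
    by (simp add: nat_pow_pow [symmetric])
  then show ?thesis
    by (simp add: n)
qed

text \<open>\<open>u\<close> is chosen so that \<open>u v\<close> is the reflection
  \<open>x -> 1 - x\<close>; as \<open>v_q\<close> is \<open>x -> -x\<close>, \<open>t\<close>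
  becomes the translation by \<open>\<one>\<close>. In \<open>root\<close> the leading term is split
  off because the relators involve only the values \<open>a i\<close> with
  \<open>i < k\<close>.\<close>

lemma relators_AGL1_trivial:
  fixes a :: "nat \<Rightarrow> int"
  assumes p: "Factorial_Ring.prime p" and k: "k \<ge> 1" and card: "card (carrier R) = p ^ k"
    and prim: "primitive_element R \<alpha>"
    and root: "\<alpha> [^] k \<oplus> eval (map (\<lambda>c. [c] \<cdot> \<one>) (map a (rev [0..<k]))) \<alpha> = \<zero>"
  defines "u \<equiv> affine_map R (\<ominus> (inv \<alpha>)) \<one>" and "v \<equiv> affine_map R \<alpha> \<zero>"
  shows "relators (AGL1 R) p k a u v \<subseteq> {\<one>\<^bsub>AGL1 R\<^esub>}"
    and "u \<otimes>\<^bsub>AGL1 R\<^esub> v \<otimes>\<^bsub>AGL1 R\<^esub> v_q (AGL1 R) (p ^ k) v = affine_map R \<one> \<one>"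
proof -
  let ?q = "p ^ k" and ?t = "affine_map R \<one> \<one>" and ?c = "\<ominus> (inv \<alpha>)"
  have q: "?q > 1"
    using prime_gt_1_nat [OF p] k by (intro one_less_power) auto
  have fin: "finite (carrier R)"
    using q card by (metis card.infinite not_one_less_zero)
  have \<alpha>: "\<alpha> \<in> carrier R - {\<zero>}"
    using prim by (simp add: primitive_element_def)
  note inv\<alpha> = nonzero_inv [OF \<alpha>]
  have char: "[p] \<cdot> \<one> = \<zero>"
    using card by (rule char_eq_zero)
  have neg1: "\<ominus> \<one> \<in> carrier R - {\<zero>}"
    using minus_minus [OF one_closed] by (auto simp del: minus_minus)
  have cinv: "?c \<in> carrier R - {\<zero>}"
    using inv\<alpha> minus_minus [of "inv \<alpha>"] by (auto simp del: minus_minus)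
  have c\<alpha>: "?c \<otimes> \<alpha> = \<ominus> \<one>"
    using \<alpha> inv\<alpha> by (simp add: l_minus)
  have even_char: "\<ominus> \<one> = \<one>" if "even ?q"
  proof -
    have "p = 2"
      using that p by (metis even_power primes_dvd_imp_eq two_is_prime_nat)
    then have "\<one> \<oplus> \<one> = \<zero>"
      using char by (simp add: numeral_2_eq_2 add.nat_pow_Suc)
    then show ?thesis
      by (simp add: minus_equality)
  qed
  have half: "\<alpha> [^] ((?q - 1) div 2) = \<ominus> \<one>" if "odd ?q"
    using primitive_element_pow_half [OF fin prim] that q card by simp
  \<comment> \<open>Both parities give one formula: for even \<open>?q\<close> the identity is
    prescribed, and there \<open>\<ominus> \<one> = \<one>\<close>.\<close>
  have vq: "v_q (AGL1 R) ?q v = affine_map R (\<ominus> \<one>) \<zero>"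
  proof (cases "even ?q")
    case True
    then show ?thesis
      using even_char [OF True] unfolding v_q_def by (simp only: if_True one_AGL1)
  next
    case False
    then show ?thesis
      using half [OF False] \<alpha> unfolding v_q_def v_def by (simp only: if_False dilation_nat_pow)
  qed
  have uv: "u \<otimes>\<^bsub>AGL1 R\<^esub> v = affine_map R (\<ominus> \<one>) \<one>"
    using \<alpha> cinv c\<alpha> by (simp add: u_def v_def mult_AGL1)
  show uvvq: "u \<otimes>\<^bsub>AGL1 R\<^esub> v \<otimes>\<^bsub>AGL1 R\<^esub> v_q (AGL1 R) ?q v = ?t"
    unfolding uv vq using neg1 by (simp add: mult_AGL1 l_minus)
  have "v [^]\<^bsub>AGL1 R\<^esub> (?q - 1) = \<one>\<^bsub>AGL1 R\<^esub>"
    using \<alpha> nonzero_pow_card_pred [OF fin \<alpha>] card by (simp add: v_def dilation_nat_pow one_AGL1)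
  moreover have "(u \<otimes>\<^bsub>AGL1 R\<^esub> v) [^]\<^bsub>AGL1 R\<^esub> (2::nat) = \<one>\<^bsub>AGL1 R\<^esub>"
    unfolding uv using neg1 AGL1.nat_pow_Suc
    by (simp add: numeral_2_eq_2 mult_AGL1 one_AGL1 l_minus l_neg affine_map_closed)
  moreover have "?t [^]\<^bsub>AGL1 R\<^esub> p = \<one>\<^bsub>AGL1 R\<^esub>"
    by (simp add: translation_nat_pow char one_AGL1)
  moreover have "u [^]\<^bsub>AGL1 R\<^esub> ell ?q = \<one>\<^bsub>AGL1 R\<^esub>"
  proof (cases "?q \<in> {2, 3}")
    case True
    \<comment> \<open>For \<open>?q\<close> equal to 2 or 3 a primitive element can only be
      \<open>\<ominus> \<one>\<close>. Then \<open>u\<close> itself is the translation by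
      \<open>\<one>\<close>, whence the exceptional value \<open>ell ?q = ?q\<close>.\<close>
    have "\<alpha> = \<ominus> \<one>"
    proof (cases "?q = 2")
      case True
      then show ?thesis
        using even_char nonzero_pow_card_pred [OF fin \<alpha>] \<alpha> card by simp
    next
      case False
      then have "?q = 3"
        using True by simp
      then show ?thesis
        using half \<alpha> by simp
    qed
    then have "?c = \<one>"
      using c\<alpha> cinv by (metis Diff_iff l_one minus_equality m_comm minus_minus one_closed r_minus r_one)
    moreover have "[?q] \<cdot> \<one> = \<zero>"
      using group.pow_order_eq_1 [OF a_group, of \<one>] card by (simp add: order_def add_pow_def)
    ultimately show ?thesis
      using True by (simp add: u_def ell_def translation_nat_pow one_AGL1)
  next
    case False
    then have q3: "?q > 3"
      using q by auto
    \<comment> \<open>For larger \<open>?q\<close> it suffices to control the factor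
      \<open>?c\<close> of \<open>u\<close>. If it were \<open>\<one>\<close>, then
      \<open>\<alpha>\<close> would be \<open>\<ominus> \<one>\<close>, whose order is at most
      two.\<close>
    have "?c \<noteq> \<one>"
    proof
      assume "?c = \<one>"
      then have "\<alpha> = \<ominus> \<one>"
        using c\<alpha> \<alpha> by simp
      then have "\<alpha> [^] (2::nat) = \<one>"
        by (simp add: numeral_2_eq_2 l_minus)
      then have "?q - 1 dvd 2"
        using primitive_element_pow_eq_one_iff [OF fin prim] card by simp
      then show False
        using q3 by (auto dest: dvd_imp_le)
    qed
    moreover have "?c [^] ell ?q = \<one>"
    proof (cases "even ?q \<or> ?q mod 4 = 1")
      case True
      then have "ell ?q = ?q - 1"
        using False by (simp only: ell_def if_True if_False)
      then show ?thesis
        using nonzero_pow_card_pred [OF fin cinv] card by simp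
    next
      case mod4: False
      let ?m = "(?q - 1) div 2"
      have ell: "ell ?q = ?m"
        using False mod4 by (simp only: ell_def if_False)
      \<comment> \<open>Here \<open>?q mod 4 = 3\<close>, so \<open>?m\<close> is odd and both
        \<open>(?c \<otimes> \<alpha>) [^] ?m\<close> and \<open>\<alpha> [^] ?m\<close> equal
        \<open>\<ominus> \<one>\<close>. Cancelling shows that half of \<open>?q - 1\<close> already
        kills \<open>?c\<close>.\<close>
      have "odd ?m"
        using mod4 by presburger
      then have "(?c \<otimes> \<alpha>) [^] ?m = \<ominus> \<one>"
        unfolding c\<alpha> by (rule minus_one_pow_odd)
      moreover have "(?c \<otimes> \<alpha>) [^] ?m = ?c [^] ?m \<otimes> \<alpha> [^] ?m"
        using cinv \<alpha> by (intro pow_mult_distrib) (auto simp: m_comm)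
      ultimately have "?c [^] ?m \<otimes> \<alpha> [^] ?m = \<ominus> \<one>"
        by simp
      then have "?c [^] ?m \<otimes> \<ominus> \<one> = \<ominus> \<one>"
        using half mod4 by simp
      then show ?thesis
        unfolding ell using nonzero_pow_closed [OF cinv, of ?m]
        by (metis DiffD1 minus_minus one_closed r_minus r_one)
    qed
    ultimately show ?thesis
      unfolding u_def using cinv by (intro affine_map_pow_eq_one) auto
  qed
  moreover have "commutator (AGL1 R) ?t (conj_pow (AGL1 R) v i ?t) = \<one>\<^bsub>AGL1 R\<^esub>" for i
    unfolding v_def conj_pow_translation [OF \<alpha> one_closed] using \<alpha>
    by (subst AGL1.commutator_eq_one_iff) (auto simp: mult_AGL1 a_comm intro!: affine_map_closed)
  \<comment> \<open>The first factor translates by \<open>\<alpha>^k\<close> and the product by the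
    lower terms; the total is the left side of \<open>root\<close>.\<close>
  moreover have "conj_pow (AGL1 R) v k ?t \<otimes>\<^bsub>AGL1 R\<^esub>
      list_prod (AGL1 R) (map (\<lambda>i. conj_pow (AGL1 R) v i ?t [^]\<^bsub>AGL1 R\<^esub> a i) [0..<k]) = \<one>\<^bsub>AGL1 R\<^esub>"
  proof -
    let ?e = "eval (map (\<lambda>c. [c] \<cdot> \<one>) (map a (rev [0..<k]))) \<alpha>"
    have e: "?e \<in> carrier R"
      using \<alpha> by (intro eval_in_carrier) auto
    have "conj_pow (AGL1 R) v i ?t [^]\<^bsub>AGL1 R\<^esub> a i = affine_map R \<one> ([a i] \<cdot> (\<alpha> [^] i))" for i
      unfolding v_def conj_pow_translation [OF \<alpha> one_closed] using \<alpha> by (simp add: translation_int_pow)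
    then show ?thesis
      using \<alpha> list_prod_translations [of \<alpha> a k] e root
      by (simp add: v_def conj_pow_translation mult_AGL1 one_AGL1 a_comm)
  qed
  ultimately show "relators (AGL1 R) p k a u v \<subseteq> {\<one>\<^bsub>AGL1 R\<^esub>}"
    unfolding relators_def Let_def uvvq by auto
qed

end

section \<open>Roots of irreducible polynomials\<close>

text \<open>Polynomials are lists without leading zero, \<open>[]\<close> being the zero polynomial.
  Those of length exactly \<open>n + 1\<close> have a nonzero head and an arbitrary tail, and
  \<open>q^n + (q - 1) q^n = q^(n+1)\<close>.\<close>

lemma (in ring) card_bounded_degree_polynomials:
  assumes "finite (carrier R)"
  shows "finite {f \<in> carrier (poly_ring R). length f \<le> n}
    \<and> card {f \<in> carrier (poly_ring R). length f \<le> n} = card (carrier R) ^ n"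
proof (induction n)
  case 0
  have "{f \<in> carrier (poly_ring R). length f \<le> 0} = {[]}"
    by (auto simp: univ_poly_zero_closed)
  then show ?case
    by simp
next
  case (Suc n)
  let ?q = "card (carrier R)" and ?P = "\<lambda>n. {f \<in> carrier (poly_ring R). length f \<le> n}"
  let ?L = "{w. set w \<subseteq> carrier R \<and> length w = n}"
  let ?T = "(\<lambda>(a, w). a # w) ` ((carrier R - {\<zero>}) \<times> ?L)"
  have split: "?P (Suc n) = ?P n \<union> ?T"
  proof (intro equalityI subsetI)
    fix f assume f: "f \<in> ?P (Suc n)"
    show "f \<in> ?P n \<union> ?T"
    proof (cases "length f = Suc n")
      case True
      then obtain a w where "f = a # w" "length w = n"
        by (auto simp: length_Suc_conv)
      then show ?thesis
        using f by (auto simp: univ_poly_def polynomial_def)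
    qed (use f in auto)
  qed (auto simp: univ_poly_def polynomial_def)
  have L: "finite ?L" "card ?L = ?q ^ n"
    using assms finite_lists_length_eq [of "carrier R" n] card_lists_length_eq [of "carrier R" n] by auto
  have "inj_on (\<lambda>(a, w). a # w) ((carrier R - {\<zero>}) \<times> ?L)"
    by (auto simp: inj_on_def)
  then have T: "finite ?T" "card ?T = (?q - 1) * ?q ^ n"
    using L assms by (auto simp: card_image card_cartesian_product card_Diff_singleton)
  have "card (?P n \<union> ?T) = card (?P n) + card ?T"
    using Suc T(1) by (intro card_Un_disjoint) auto
  then have "card (?P (Suc n)) = ?q ^ n + (?q - 1) * ?q ^ n"
    unfolding split using Suc T by simp
  also have "\<dots> = Suc (?q - 1) * ?q ^ n"
    by simp
  also have "Suc (?q - 1) = ?q"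
  proof -
    have "?q > 0"
      using assms zero_closed by (metis card_gt_0_iff empty_iff)
    then show ?thesis
      by (rule Suc_diff_1)
  qed
  finally have "card (?P (Suc n)) = ?q ^ Suc n"
    by simp
  moreover have "finite (?P (Suc n))"
    unfolding split using Suc T(1) by blast
  ultimately show ?case
    by blast
qed

text \<open>Each residue class modulo \<open>f\<close> contains exactly one remainder.\<close>

lemma (in field) card_rupture:
  assumes "finite (carrier R)" "f \<in> carrier (poly_ring R)" "f \<noteq> []"
  shows "card (carrier (Rupt (carrier R) f)) = card (carrier R) ^ degree f"
proof -
  \<comment> \<open>\<open>length g \<le> degree f\<close> says that \<open>g\<close> is zero or of
    smaller degree than \<open>f\<close>.\<close>
  let ?P = "{g \<in> carrier (poly_ring R). length g \<le> degree f}"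
  have P: "(\<lambda>g. g pmod f) ` carrier (poly_ring R) = ?P"
    using pmod_image_characterization [OF carrier_is_subfield assms(2,3)] .
  have "carrier (Rupt (carrier R) f) = rupture_surj (carrier R) f ` ?P"
    using rupture_carrier_as_pmod_image [OF carrier_is_subfield assms(2)] unfolding P by simp
  then show ?thesis
    using rupture_surj_inj_on [OF carrier_is_subfield assms(2)]
      card_bounded_degree_polynomials [OF assms(1), of "degree f"]
    unfolding P by (simp add: card_image)
qed

lemma (in field) finite_field_pow_card:
  assumes "finite (carrier R)" "x \<in> carrier R"
  shows "x [^] card (carrier R) = x"
proof -
  have "card (carrier R) > 0"
    using assms by (auto simp: card_gt_0_iff)
  then obtain n where n: "card (carrier R) = Suc n"
    using gr0_implies_Suc by blast
  then show ?thesis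
    using assms nonzero_pow_card_pred [of x] by (cases "x = \<zero>") auto
qed

text \<open>The class of \<open>X\<close> lies in the residue field of \<open>f\<close>, whose order is \<open>card (carrier R) ^ degree f\<close>.\<close>

lemma (in field) pirreducible_divides_var_pow:
  assumes fin: "finite (carrier R)" and f: "f \<in> carrier (poly_ring R)"
    and irr: "pirreducible (carrier R) f"
  shows "f divides\<^bsub>poly_ring R\<^esub>
    (X [^]\<^bsub>poly_ring R\<^esub> (card (carrier R) ^ degree f) \<ominus>\<^bsub>poly_ring R\<^esub> X)"
proof -
  let ?q = "card (carrier R) ^ degree f" and ?h = "rupture_surj (carrier R) f"
  have f0: "f \<noteq> []"
    using irr pirreducibleE(1) [OF carrier_is_subring f] by simp
  interpret UP: domain "poly_ring R"
    using univ_poly_is_domain [OF carrier_is_subring] .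
  interpret L: field "Rupt (carrier R) f"
    using rupture_is_field_iff_pirreducible [OF carrier_is_subfield f] irr by simp
  interpret h: ring_hom_ring "poly_ring R" "Rupt (carrier R) f" ?h
    using rupture_surj_hom(2) [OF carrier_is_subring f] .
  have card: "card (carrier (Rupt (carrier R) f)) = ?q"
    using card_rupture [OF fin f f0] .
  have "card (carrier R) > 0"
    using fin by (auto simp: card_gt_0_iff)
  then have finL: "finite (carrier (Rupt (carrier R) f))"
    by (intro card_ge_0_finite) (simp add: card)
  have X: "X \<in> carrier (poly_ring R)"
    using var_closed(1) [OF carrier_is_subring] .
  have "?h (X [^]\<^bsub>poly_ring R\<^esub> ?q) = ?h X"
    using h.hom_nat_pow [OF X, of ?q] L.finite_field_pow_card [OF finL h.hom_closed [OF X]] card by simp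
  then have "X [^]\<^bsub>poly_ring R\<^esub> ?q \<ominus>\<^bsub>poly_ring R\<^esub> X \<in> PIdl\<^bsub>poly_ring R\<^esub> f"
    using UP.quotient_eq_iff_same_a_r_cos [OF UP.cgenideal_ideal [OF f] UP.nat_pow_closed [OF X] X] by simp
  then show ?thesis
    using f by (auto simp: cgenideal_def factor_def UP.m_comm)
qed

text \<open>Applying \<open>h\<close> coefficientwise may create leading zeros, so
  \<open>map h f\<close> need not be a polynomial over \<open>S\<close>. Evaluation ignores leading
  zeros, which is why sums and products pass through \<open>normalize\<close>.\<close>

lemma (in ring_hom_ring) eval_map_ring_hom:
  assumes "domain R" "cring S" "x \<in> carrier S"
  shows "(\<lambda>f. S.eval (map h f) x) \<in> ring_hom (poly_ring R) S"
proof -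
  interpret R: domain R by fact
  interpret S: cring S by fact
  have sub: "set (map h f) \<subseteq> carrier S" if "set f \<subseteq> carrier R" for f
    using that by auto
  have car: "set f \<subseteq> carrier R" if "f \<in> carrier (poly_ring R)" for f
    using that by (auto simp: univ_poly_def polynomial_def)
  show ?thesis
  proof (rule ring_hom_memI)
    fix f g assume "f \<in> carrier (poly_ring R)" "g \<in> carrier (poly_ring R)"
    then have f: "set f \<subseteq> carrier R" and g: "set g \<subseteq> carrier R"
      by (simp_all add: car)
    have "S.eval (map h (R.poly_mult f g)) x = S.eval (S.normalize (map h (R.poly_mult f g))) x"
      using S.eval_normalize [OF sub [OF R.poly_mult_in_carrier [OF f g]] assms(3)] by simp
    also have "\<dots> = S.eval (map h f) x \<otimes>\<^bsub>S\<^esub> S.eval (map h g) x"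
      unfolding poly_mult_hom' [OF f g] by (rule S.eval_poly_mult [OF sub [OF f] sub [OF g] assms(3)])
    finally show "S.eval (map h (f \<otimes>\<^bsub>poly_ring R\<^esub> g)) x = S.eval (map h f) x \<otimes>\<^bsub>S\<^esub> S.eval (map h g) x"
      by (simp add: univ_poly_mult)
    have "S.eval (map h (R.poly_add f g)) x = S.eval (S.normalize (map h (R.poly_add f g))) x"
      using S.eval_normalize [OF sub [OF R.poly_add_in_carrier [OF f g]] assms(3)] by simp
    also have "\<dots> = S.eval (map h f) x \<oplus>\<^bsub>S\<^esub> S.eval (map h g) x"
      unfolding poly_add_hom' [OF f g] by (rule S.eval_poly_add [OF sub [OF f] sub [OF g] assms(3)])
    finally show "S.eval (map h (f \<oplus>\<^bsub>poly_ring R\<^esub> g)) x = S.eval (map h f) x \<oplus>\<^bsub>S\<^esub> S.eval (map h g) x"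
      by (simp add: univ_poly_add)
  qed (use assms(3) car sub S.eval_in_carrier in \<open>auto simp: univ_poly_one\<close>)
qed

lemma (in field) card_zeros_le_degree:
  assumes "f \<in> carrier (poly_ring R)" "f \<noteq> []"
  shows "card {x \<in> carrier R. eval f x = \<zero>} \<le> degree f"
proof -
  have "{x \<in> carrier R. eval f x = \<zero>} = set_mset (roots f)"
    using roots_mem_iff_is_root [OF assms(1)] assms(2) by (auto simp: is_root_def)
  also have "card \<dots> \<le> size (roots f)"
    unfolding size_multiset_overloaded_eq card_eq_sum by (intro sum_mono) simp
  also have "\<dots> \<le> degree f"
    using size_roots_le_degree [OF assms(1)] .
  finally show ?thesis .
qed

text \<open>The cofactor of \<open>f\<close> in \<open>X\<^sup>q - X\<close> has degree less than \<open>q\<close>, so it misses one of the \<open>q\<close>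
  roots of \<open>X\<^sup>q - X\<close>.\<close>

lemma (in ring_hom_ring) pirreducible_has_root:
  assumes R: "field R" and S: "field S" and fin: "finite (carrier R)"
    and f: "f \<in> carrier (poly_ring R)" "pirreducible\<^bsub>R\<^esub> (carrier R) f" "degree f > 0"
    and card: "card (carrier S) = card (carrier R) ^ degree f"
  shows "\<exists>x\<in>carrier S. S.eval (map h f) x = \<zero>\<^bsub>S\<^esub>"
proof (rule ccontr)
  assume no: "\<not> ?thesis"
  interpret R: field R by fact
  interpret S: field S by fact
  interpret UP: domain "poly_ring R"
    using R.univ_poly_is_domain [OF R.carrier_is_subring] .
  let ?q = "card (carrier R) ^ degree f"
  let ?X = "X\<^bsub>R\<^esub>" and ?Y = "X\<^bsub>R\<^esub> [^]\<^bsub>poly_ring R\<^esub> ?q"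
  have X: "?X \<in> carrier (poly_ring R)"
    using R.var_closed(1) [OF R.carrier_is_subring] .
  have "card {\<zero>\<^bsub>R\<^esub>, \<one>\<^bsub>R\<^esub>} \<le> card (carrier R)"
    using fin by (intro card_mono) auto
  then have "card (carrier R) > 1"
    by simp
  then have q: "?q > 1"
    using f(3) by (rule one_less_power)
  have finS: "finite (carrier S)"
    using q card by (metis card.infinite not_one_less_zero)
  obtain g where g: "g \<in> carrier (poly_ring R)" "?Y \<ominus>\<^bsub>poly_ring R\<^esub> ?X = f \<otimes>\<^bsub>poly_ring R\<^esub> g"
    using R.pirreducible_divides_var_pow [OF fin f(1,2)] by (auto simp: factor_def)
  have Y: "?Y = \<one>\<^bsub>R\<^esub> # replicate ?q \<zero>\<^bsub>R\<^esub>"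
    using R.unitary_monom_eq_var_pow [OF R.carrier_is_subring, of ?q] by (simp add: R.monom_def)
  \<comment> \<open>With a zero cofactor \<open>X^q\<close> and \<open>X\<close> would coincide, but
    their lists have lengths \<open>q + 1\<close> and 2.\<close>
  have g0: "g \<noteq> []"
  proof
    assume "g = []"
    then have "?Y \<ominus>\<^bsub>poly_ring R\<^esub> ?X = \<zero>\<^bsub>poly_ring R\<^esub>"
      using g(2) UP.r_null [OF f(1)] by (simp add: univ_poly_zero)
    then have "?Y = ?X"
      using X UP.nat_pow_closed [OF X] by simp
    then have "length (\<one>\<^bsub>R\<^esub> # replicate ?q \<zero>\<^bsub>R\<^esub>) = length ?X"
      unfolding Y by simp
    then show False
      using q by (auto simp: var_def)
  qed
  have "degree f + degree g = degree (f \<otimes>\<^bsub>poly_ring R\<^esub> g)"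
    using R.poly_mult_degree_eq [OF R.carrier_is_subring, of f g] f g g0
    by (auto simp: univ_poly_carrier univ_poly_mult)
  also have "\<dots> = degree (R.poly_add ?Y (\<ominus>\<^bsub>poly_ring R\<^esub> ?X))"
    by (simp add: g(2) [symmetric] a_minus_def univ_poly_add)
  also have "\<dots> \<le> max (degree ?Y) (degree (\<ominus>\<^bsub>poly_ring R\<^esub> ?X))"
    by (rule R.poly_add_degree)
  also have "\<dots> = ?q"
  proof -
    have "degree ?Y = ?q"
      unfolding Y by simp
    moreover have "degree (\<ominus>\<^bsub>poly_ring R\<^esub> ?X) = 1"
      using R.univ_poly_a_inv_degree [OF R.carrier_is_subring X] by (simp add: var_def)
    ultimately show ?thesis
      using q by simp
  qed
  finally have deg: "degree g < ?q"
    using f(3) by simp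
  \<comment> \<open>The values of \<open>f\<close> and \<open>g\<close> at \<open>x\<close> multiply
    to \<open>x^q - x\<close>, which is zero in \<open>S\<close>. By the contrary assumption the
    first factor is nonzero.\<close>
  have "S.eval (map h g) x = \<zero>\<^bsub>S\<^esub>" if x: "x \<in> carrier S" for x
  proof -
    interpret e: ring_hom_ring "poly_ring R" S "\<lambda>f. S.eval (map h f) x"
      using ring_hom_ringI2 [OF UP.ring_axioms S.ring_axioms
          eval_map_ring_hom [OF R.domain_axioms S.cring_axioms x]] .
    have eX: "S.eval (map h ?X) x = x"
      using x by (simp add: var_def)
    have "S.eval (map h f) x \<otimes>\<^bsub>S\<^esub> S.eval (map h g) x = S.eval (map h (?Y \<ominus>\<^bsub>poly_ring R\<^esub> ?X)) x"
      using f(1) g by simp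
    also have "\<dots> = S.eval (map h ?X) x [^]\<^bsub>S\<^esub> ?q \<ominus>\<^bsub>S\<^esub> S.eval (map h ?X) x"
      using X e.hom_nat_pow [OF X, of ?q] UP.nat_pow_closed [OF X, of ?q]
      by (simp add: a_minus_def)
    also have "\<dots> = \<zero>\<^bsub>S\<^esub>"
      unfolding eX using S.finite_field_pow_card [OF finS x] x card by simp
    finally show ?thesis
      using no x S.integral [of "S.eval (map h f) x" "S.eval (map h g) x"]
        e.hom_closed [OF f(1)] e.hom_closed [OF g(1)] by auto
  qed
  then have zeros: "{x \<in> carrier S. S.eval (map h g) x = \<zero>\<^bsub>S\<^esub>} = carrier S"
    by auto
  have gR: "set g \<subseteq> carrier R" "lead_coeff g \<noteq> \<zero>\<^bsub>R\<^esub>"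
    using g(1) g0 by (auto simp: univ_poly_def polynomial_def)
  \<comment> \<open>A homomorphism of fields is injective, so the leading coefficient survives and
    \<open>map h g\<close> is a polynomial of the same degree as \<open>g\<close>.\<close>
  have "h c \<noteq> \<zero>\<^bsub>S\<^esub>" if "c \<in> carrier R" "c \<noteq> \<zero>\<^bsub>R\<^esub>" for c
  proof
    assume "h c = \<zero>\<^bsub>S\<^esub>"
    have c: "c \<in> carrier R - {\<zero>\<^bsub>R\<^esub>}"
      using that by simp
    have "h (c \<otimes>\<^bsub>R\<^esub> inv\<^bsub>R\<^esub> c) = h c \<otimes>\<^bsub>S\<^esub> h (inv\<^bsub>R\<^esub> c)"
      using R.nonzero_inv(1) [OF c] c by (intro hom_mult) auto
    then show False
      using R.nonzero_inv(1,3) [OF c] \<open>h c = \<zero>\<^bsub>S\<^esub>\<close> by simp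
  qed
  then have "map h g \<in> carrier (poly_ring S)" "map h g \<noteq> []"
    using gR g0 subsetD [OF gR(1) hd_in_set [OF g0]] by (auto simp: univ_poly_def polynomial_def hd_map)
  then have "card (carrier S) \<le> degree (map h g)"
    using S.card_zeros_le_degree [of "map h g"] zeros by simp
  then show False
    using deg card by simp
qed

text \<open>Since \<open>[p] \<cdot> \<one>\<close> vanishes, congruent integers have the same
  multiple of \<open>\<one>\<close>, and the reduction inside the operations of
  \<open>residue_ring\<close> becomes invisible.\<close>

lemma (in field) residue_ring_hom:
  assumes p: "Factorial_Ring.prime p" and char: "[p] \<cdot> \<one> = \<zero>"
  shows "(\<lambda>c. [c] \<cdot> \<one>) \<in> ring_hom (residue_ring (int p)) R"
proof -
  interpret Z: residues_prime p "residue_ring (int p)"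
    using p by unfold_locales auto
  have mod: "[(c mod int p)] \<cdot> \<one> = [c] \<cdot> \<one>" for c :: int
  proof -
    have "[(int p)] \<cdot> \<one> = \<zero>"
      using char by (simp add: add_pow_int_ge)
    then have "[(int p * (c div int p))] \<cdot> \<one> = \<zero>"
      using add.int_pow_pow [of \<one> "c div int p" "int p"] by (simp add: mult.commute add.int_pow_one)
    then have "[(int p * (c div int p) + c mod int p)] \<cdot> \<one> = [(c mod int p)] \<cdot> \<one>"
      using add.int_pow_mult [of \<one> "int p * (c div int p)" "c mod int p"] by simp
    then show ?thesis
      by simp
  qed
  show ?thesis
  proof (rule ring_hom_memI)
    fix x y :: int
    show "[(x \<otimes>\<^bsub>residue_ring (int p)\<^esub> y)] \<cdot> \<one> = [x] \<cdot> \<one> \<otimes> [y] \<cdot> \<one>"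
      by (simp add: Z.res_mult_eq mod add_pow_ldistr_int add.int_pow_pow mult.commute)
    show "[(x \<oplus>\<^bsub>residue_ring (int p)\<^esub> y)] \<cdot> \<one> = [x] \<cdot> \<one> \<oplus> [y] \<cdot> \<one>"
      by (simp add: Z.res_add_eq mod add.int_pow_mult)
    show "[\<one>\<^bsub>residue_ring (int p)\<^esub>] \<cdot> \<one> = \<one>"
      by (simp add: Z.res_one_eq add_pow_int_ge)
  qed simp
qed

section \<open>The isomorphism\<close>

lemma range_gen: "range f = {f U, f V}"
proof
  show "range f \<subseteq> {f U, f V}"
  proof (rule image_subsetI)
    fix x show "f x \<in> {f U, f V}"
      by (cases x) auto
  qed
qed auto

theorem theorem4p1:
  fixes F :: "('a, 'b) ring_scheme" and p k :: nat and \<mu> :: "int list"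
  assumes "Factorial_Ring.prime p"
    and "k \<ge> 1"
    and "field F"
    and "card (carrier F) = p ^ k"
    and "monic_primitive_poly p k F \<mu>"
  shows "H_group p k \<mu> \<cong> AGL1 F"
proof -
  interpret F: field F by fact
  let ?Z = "residue_ring (int p)"
  interpret Z: residues_prime p ?Z
    using assms(1) by unfold_locales auto
  let ?a = "ring.coeff ?Z \<mu>" and ?e = "\<lambda>c::int. [c] \<cdot>\<^bsub>F\<^esub> \<one>\<^bsub>F\<^esub>"
  note \<mu> = assms(5) [unfolded monic_primitive_poly_def]
  have p: "p > 1"
    using assms(1) by (rule prime_gt_1_nat)
  have q: "p ^ k > 1"
    using p assms(2) by (intro one_less_power) auto
  have fin: "finite (carrier F)"
    using q assms(4) by (metis card.infinite not_one_less_zero)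
  interpret e: ring_hom_ring ?Z F ?e
    using F.residue_ring_hom [OF assms(1) F.char_eq_zero [OF assms(4)]]
    by (rule ring_hom_ringI2 [OF Z.ring_axioms F.ring_axioms])
  \<comment> \<open>\<open>degree\<close> is the truncated \<open>length - 1\<close>;
    \<open>k \<ge> 1\<close> rules out the empty list.\<close>
  have len: "length \<mu> = Suc k"
    using \<mu> assms(2) by auto
  have "card (carrier ?Z) = p"
    by (simp add: Z.res_carrier_eq)
  then obtain \<alpha> where \<alpha>: "\<alpha> \<in> carrier F" "F.eval (map ?e \<mu>) \<alpha> = \<zero>\<^bsub>F\<^esub>"
    using e.pirreducible_has_root [OF Z.field_axioms F.field_axioms, of \<mu>] \<mu> len assms(2,4) Z.finite
    by auto
  then have prim: "primitive_element F \<alpha>"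
    using \<mu> by blast
  \<comment> \<open>Monicity splits off \<open>\<alpha>^k\<close>, matching \<open>W\<close>, where
    the conjugate of index \<open>k\<close> occurs with exponent one.\<close>
  have "?a k = \<one>\<^bsub>?Z\<^esub>"
    using Z.lead_coeff_simp [of \<mu>] \<mu> len by (cases \<mu>) auto
  then have "map ?e (map ?a (rev [0..<Suc k])) = \<one>\<^bsub>F\<^esub> # map ?e (map ?a (rev [0..<k]))"
    by simp
  moreover have "map ?a (rev [0..<Suc k]) = \<mu>"
    using Z.coeff_list [of \<mu>] unfolding len .
  ultimately have "map ?e \<mu> = \<one>\<^bsub>F\<^esub> # map ?e (map ?a (rev [0..<k]))"
    by (simp only:)
  then have root: "\<alpha> [^]\<^bsub>F\<^esub> k \<oplus>\<^bsub>F\<^esub> F.eval (map ?e (map ?a (rev [0..<k]))) \<alpha> = \<zero>\<^bsub>F\<^esub>"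
    using \<alpha> by simp

  \<comment> \<open>Once \<open>v\<close> is fixed and \<open>v_q\<close> is \<open>x -> -x\<close>,
    this \<open>u\<close> is the only one for which \<open>u v v_q\<close> is the translation by
    \<open>\<one>\<close>.\<close>
  define u v where "u = affine_map F (\<ominus>\<^bsub>F\<^esub> (inv\<^bsub>F\<^esub> \<alpha>)) \<one>\<^bsub>F\<^esub>" and "v = affine_map F \<alpha> \<zero>\<^bsub>F\<^esub>"
  note AGL_rel = F.relators_AGL1_trivial [OF assms(1,2,4) prim root, folded u_def v_def]
  have \<alpha>0: "\<alpha> \<in> carrier F - {\<zero>\<^bsub>F\<^esub>}"
    using prim by (simp add: primitive_element_def)
  have uv: "u \<in> carrier (AGL1 F)" "v \<in> carrier (AGL1 F)"
    using \<alpha>0 F.nonzero_inv(1) [OF \<alpha>0] F.minus_minus [of "inv\<^bsub>F\<^esub> \<alpha>"]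
    by (auto simp: u_def v_def intro!: F.affine_map_closed simp del: F.minus_minus)
  \<comment> \<open>The translation by \<open>\<one>\<close> is a word in \<open>u\<close> and
    \<open>v\<close>, and together with \<open>v\<close> it generates.\<close>
  have gen_uv: "generate (AGL1 F) {u, v} = carrier (AGL1 F)"
  proof -
    have S: "subgroup (generate (AGL1 F) {u, v}) (AGL1 F)"
      using uv by (intro F.AGL1.generate_is_subgroup) auto
    have mem: "u \<in> generate (AGL1 F) {u, v}" "v \<in> generate (AGL1 F) {u, v}"
      by (auto intro: generate.incl)
    have "v_q (AGL1 F) (p ^ k) v \<in> generate (AGL1 F) {u, v}"
      using F.AGL1.subgroup_v_q_closed [OF S mem(2)] .
    then have "affine_map F \<one>\<^bsub>F\<^esub> \<one>\<^bsub>F\<^esub> \<in> generate (AGL1 F) {u, v}"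
      unfolding AGL_rel(2) [symmetric] using mem by (intro generate.eng)
    then have "generate (AGL1 F) {affine_map F \<one>\<^bsub>F\<^esub> \<one>\<^bsub>F\<^esub>, v} \<subseteq> generate (AGL1 F) {u, v}"
      using mem by (intro F.AGL1.generate_subgroup_incl [OF _ S]) auto
    then show ?thesis
      using F.generate_AGL1 [OF fin prim] subgroup.subset [OF S] unfolding v_def by auto
  qed

  let ?R = "relators free_group p k ?a (free_gen U) (free_gen V)"
  let ?U = "presented_gen ?R U" and ?V = "presented_gen ?R V"
  have H: "H_group p k \<mu> = presented_group ?R"
    by (simp add: H_group_def)
  have R: "?R \<subseteq> carrier free_group"
    using group.relators_closed [OF group_free_group free_gen_closed free_gen_closed] .
  interpret H: group "presented_group ?R"
    using R by (rule group_presented_group)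
  interpret proj: group_hom free_group "presented_group ?R"
      "(#>\<^bsub>free_group\<^esub>) (normal_closure free_group ?R)"
    using R by (rule presented_group_proj)

  have "range (case_gen u v) \<subseteq> carrier (AGL1 F)"
    using uv by (auto split: gen.splits)
  from F.AGL1.free_group_universal [OF this]
  obtain h where h: "h \<in> hom free_group (AGL1 F)" "\<And>g. h (free_gen g) = case_gen u v g"
    by blast
  interpret h: group_hom free_group "AGL1 F" h
    using h(1) group_free_group F.AGL1.is_group by (simp add: group_hom_def group_hom_axioms_def)
  have "h ` ?R \<subseteq> {\<one>\<^bsub>AGL1 F\<^esub>}"
    using h.hom_relators [OF free_gen_closed free_gen_closed, of p k ?a U V] AGL_rel(1) by (simp add: h(2))
  then obtain g where g: "g \<in> hom (presented_group ?R) (AGL1 F)"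
      "\<And>x. g (presented_gen ?R x) = h (free_gen x)"
    using F.AGL1.presented_group_universal [OF R h(1)] by blast
  interpret g: group_hom "presented_group ?R" "AGL1 F" g
    using g(1) by unfold_locales

  have gen: "generate (presented_group ?R) {?U, ?V} = carrier (presented_group ?R)"
    using generate_presented_gen [OF R] unfolding range_gen .
  have UV: "?U \<in> carrier (presented_group ?R)" "?V \<in> carrier (presented_group ?R)"
    by (simp_all add: presented_gen_def free_gen_closed)
  \<comment> \<open>The projection carries the relators of the free generators to those of
    \<open>?U\<close> and \<open>?V\<close>, and it kills \<open>?R\<close>; so the order bound
    applies to \<open>H\<close>.\<close>
  have "relators (presented_group ?R) p k ?a ?U ?V
      = (#>\<^bsub>free_group\<^esub>) (normal_closure free_group ?R) ` ?R"
    using proj.hom_relators [OF free_gen_closed free_gen_closed] by (simp add: presented_gen_def)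
  also have "\<dots> \<subseteq> {\<one>\<^bsub>presented_group ?R\<^esub>}"
    using presented_group_relator [OF R] by blast
  finally have bound: "finite (carrier (presented_group ?R))"
      "card (carrier (presented_group ?R)) \<le> p ^ k * (p ^ k - 1)"
    using H.card_le_if_relators_trivial [OF UV gen] p assms(2) by auto
  have surj: "g ` carrier (presented_group ?R) = carrier (AGL1 F)"
    using g.generate_img [of "{?U, ?V}"] UV gen gen_uv by (simp add: g(2) h(2))
  \<comment> \<open>The image has \<open>q (q - 1)\<close> elements and the domain at most that
    many, so the surjection \<open>g\<close> is injective.\<close>
  have "card (g ` carrier (presented_group ?R)) \<le> card (carrier (presented_group ?R))"
    using bound(1) by (rule card_image_le)
  then have "card (g ` carrier (presented_group ?R)) = card (carrier (presented_group ?R))"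
    using bound(2) F.card_AGL1 assms(4) unfolding surj by simp
  then have "inj_on g (carrier (presented_group ?R))"
    using bound(1) eq_card_imp_inj_on by blast
  then have "g \<in> iso (presented_group ?R) (AGL1 F)"
    using g(1) surj by (auto simp: iso_def bij_betw_def)
  then show ?thesis
    unfolding H is_iso_def by blast
qed

end
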